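(* Let $\mathrm{T}$ denote the class of generalized gamma convolutions and $\mathrm{BO}$ the Goldie--Steutel--Bondesson class, both on $\mathbb{R}_+=[0,\infty)$. If $\mu\in\mathrm{T}$, then the $c$-factor distribution $\mu_c$ of $\mu$ belongs to $\mathrm{BO}$ for all $c>0$, $c\ne1$. Conversely, if $\mu$ is a selfdecomposable distribution on $\mathbb{R}_+$ such that either $\mu_c\in\mathrm{BO}$ for all $c\in(0,1)$, or $\mu_c\in\mathrm{BO}$ for all $c>1$, then $\mu\in\mathrm{T}$.
   Context: The Laplace exponent $\psi_\mu$ of a probability measure $\mu$ on $\mathbb{R}_+$ is defined by $\int_{[0,\infty)}e^{-ux}\mu(dx)=e^{-\psi_\mu(u)}$, $u\ge0$. Consider Laplace exponents of the form $$\psi_\mu(u)=au+\int_{(0,\infty)}(1-e^{-ut})\frac{k(t)}{t}\,dt,\quad u\ge0,\qquad( * )$$ with $a\ge0$, $k:(0,\infty)\to[0,\infty)$, $\int_{(0,\infty)}\min(1,t)\frac{k(t)}{t}dt<\infty$. A law $\mu$ on $\mathbb{R}_+$ is in $\mathrm{T}$ if $\psi_\mu$ has the form $( * )$ with $k$ completely monotone; it is in $\mathrm{BO}$ if $\psi_\mu$ has the form $( * )$ with $t\mapsto k(t)/t$ completely monotone. A function $h:(0,\infty)\to[0,\infty)$ is completely monotone if it is $C^\infty$ and $(-1)^nh^{(n)}\ge0$ for all $n\ge0$. A law $\mu$ is selfdecomposable if, for $X\sim\mu$ and every $c\in(0,1)$, there is $Y_c$ such that $X\overset{d}{=}cX'+Y_c$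 with $X'$ a copy of $X$ independent of $Y_c$. All elements of $\mathrm{T}$ are selfdecomposable. For a selfdecomposable law $\mu$ on $\mathbb{R}_+$, the $c$-factor distribution $\mu_c$ is the (infinitely divisible) law on $\mathbb{R}_+$ with Laplace exponent $u\mapsto\psi_\mu(u)-\psi_\mu(cu)$ if $c\in(0,1)$, and with Laplace exponent $u\mapsto\psi_\mu(cu)-\psi_\mu(u)$ if $c>1$. *)

theory Defs
  imports "HOL-Probability.Probability"
begin

definition nonneg_law :: "real measure \<Rightarrow> bool" where
  "nonneg_law \<mu> \<longleftrightarrow> real_distribution \<mu> \<and> (AE x in \<mu>. 0 \<le> x)"

definition laplace_exponent :: "real measure \<Rightarrow> real \<Rightarrow> real" where
  "laplace_exponent \<mu> u = - ln (LINT x:{0..}|\<mu>. exp (- u * x))"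

lemma laplace_exponent:
  assumes "nonneg_law \<mu>" "u \<ge> 0"
  shows "(LINT x:{0..}|\<mu>. exp (- u * x)) = exp (- laplace_exponent \<mu> u)"
proof -
  interpret real_distribution \<mu> using assms(1) by (simp add: nonneg_law_def)
  have nn: "AE x in \<mu>. 0 \<le> x" using assms(1) by (simp add: nonneg_law_def)
  let ?f = "\<lambda>x. indicator {0..} x *\<^sub>R exp (- u * x) :: real"
  have int: "integrable \<mu> ?f"
    by (rule integrable_const_bound[where B = 1])
       (use assms(2) in \<open>auto simp: indicator_def intro!: AE_I2\<close>)
  have "(\<integral>x. ?f x \<partial>\<mu>) \<noteq> 0"
  proof
    assume "(\<integral>x. ?f x \<partial>\<mu>) = 0"
    then have "AE x in \<mu>. ?f x = 0"
      using int by (subst (asm) integral_nonneg_eq_0_iff_AE) auto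
    with nn have "AE x in \<mu>. False"
      by eventually_elim auto
    then show False by simp
  qed
  moreover have "(\<integral>x. ?f x \<partial>\<mu>) \<ge> 0"
    by (rule integral_nonneg_AE) auto
  ultimately have "(\<integral>x. ?f x \<partial>\<mu>) > 0" by linarith
  then show ?thesis
    by (simp add: laplace_exponent_def set_lebesgue_integral_def)
qed

definition completely_monotone :: "(real \<Rightarrow> real) \<Rightarrow> bool" where
  "completely_monotone h \<longleftrightarrow>
     (\<forall>n. \<forall>t>0. (deriv ^^ n) h differentiable (at t) \<and> (-1) ^ n * (deriv ^^ n) h t \<ge> 0)"

definition exponent_form :: "(real \<Rightarrow> real) \<Rightarrow> real \<Rightarrow> (real \<Rightarrow> real) \<Rightarrow> bool" where
  "exponent_form \<psi> a k \<longleftrightarrow>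
     a \<ge> 0 \<and> (\<forall>t>0. k t \<ge> 0) \<and>
     set_integrable lborel {0<..} (\<lambda>t. min 1 t * (k t / t)) \<and>
     (\<forall>u\<ge>0. \<psi> u = a * u + (LINT t:{0<..}|lborel. (1 - exp (- u * t)) * (k t / t)))"

definition GGC :: "real measure set" where
  "GGC = {\<mu>. nonneg_law \<mu> \<and>
            (\<exists>a k. exponent_form (laplace_exponent \<mu>) a k \<and> completely_monotone k)}"

definition BO :: "real measure set" where
  "BO = {\<mu>. nonneg_law \<mu> \<and>
           (\<exists>a k. exponent_form (laplace_exponent \<mu>) a k \<and> completely_monotone (\<lambda>t. k t / t))}"

(* In terms of laws: c X' has law distr \<mu> borel (\<lambda>x. c * x), and the sum of independent
   variables has the convolution of their laws as its law. *)
definition selfdecomposable :: "real measure \<Rightarrow> bool" where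
  "selfdecomposable \<mu> \<longleftrightarrow>
     (\<forall>c\<in>{0<..<1}. \<exists>\<nu>. real_distribution \<nu> \<and> \<mu> = (distr \<mu> borel (\<lambda>x. c * x) \<star> \<nu>))"

(* A law on the half-line is determined by its Laplace exponent, so the description is unique;
   for selfdecomposable \<mu> such a law exists for every c > 0 other than 1. *)
definition c_factor :: "real \<Rightarrow> real measure \<Rightarrow> real measure" where
  "c_factor c \<mu> = (THE \<nu>. nonneg_law \<nu> \<and>
     (\<forall>u\<ge>0. laplace_exponent \<nu> u =
        (if c < 1 then laplace_exponent \<mu> u - laplace_exponent \<mu> (c * u)
         else laplace_exponent \<mu> (c * u) - laplace_exponent \<mu> u)))"

end

theory Submission
  imports Defs
begin

text \<open>Let \<open>\<psi>\<close> have Levy density \<open>m(t) = k(t)/t\<close>. Then \<open>\<psi>(u) - \<psi>(c u)\<close> has Levy density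
  \<open>l\<^sub>c(t) = (k(t) - k(t/c))/t\<close>. If \<open>k\<close> has signed derivatives \<open>G\<^sub>n = (-1)\<^sup>n k\<^sup>(\<^sup>n\<^sup>)\<close>, the \<open>n\<close>-th signed
  derivative of \<open>l\<^sub>c\<close> at \<open>t\<close> is \<open>t\<^sup>-\<^sup>n\<^sup>-\<^sup>1\<close> times the integral of \<open>s\<^sup>n G\<^sub>n\<^sub>+\<^sub>1(s)\<close> over \<open>[t, t/c]\<close>; hence all
  \<open>l\<^sub>c\<close>, \<open>0 < c < 1\<close>, are completely monotone iff \<open>k\<close> is. For the converse one must first produce a smooth
  \<open>m\<close>: summing \<open>\<psi>(u/2\<^sup>j) - \<psi>(u/2\<^sup>j\<^sup>+\<^sup>1)\<close> over \<open>j\<close> writes \<open>m\<close> as a convergent series of completely monotone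
  functions, and uniqueness of the Levy density gives \<open>l\<^sub>c(t) = m(t) - m(t/c)/c\<close> for every other \<open>c\<close>.
  Factors with \<open>c > 1\<close> are dilations of those with \<open>1/c\<close>. In the forward direction the law of the
  factor has to be constructed; it is a weak limit of convolution powers.\<close>

subsection \<open>Completely monotone functions\<close>

text \<open>The obstacle in the converse is regularity. The sign criterion compares increments of
  \<open>moment_primitive\<close>, so it presupposes that \<open>k\<close> has derivatives of all
  orders, whereas at the outset \<open>\<mu>\<close> comes without any Levy density. Its exponent is
  therefore rebuilt from the single factor c = 1/2: telescoping works because
  \<open>\<psi>(u/2^j)\<close> tends to 0, and positivity of the terms turns convergence of
  integrals into convergence of densities. Only then do the other values of c enter, and all of them
  are used, since the ratios 1/c must reach every interval of the half-line. Levy densities are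
  unique only almost everywhere; completely monotone functions are continuous, which makes the
  resulting identities pointwise.

  \<open>c_factor\<close> is a definite description, so nothing can be said about it before a law
  with the right exponent is exhibited. In the converse selfdecomposability supplies one, once the
  factor, a priori any law on the real line, is shown to live on the half-line.\<close>

definition alternating_derivs :: "(nat \<Rightarrow> real \<Rightarrow> real) \<Rightarrow> bool" where
  "alternating_derivs G \<longleftrightarrow> (\<forall>n. \<forall>t>0. (G n has_real_derivative - G (Suc n) t) (at t))"

lemma alternating_derivsD:
  "alternating_derivs G \<Longrightarrow> 0 < t \<Longrightarrow> (G n has_real_derivative - G (Suc n) t) (at t)"
  by (simp add: alternating_derivs_def)

text \<open>A derivative depends only on values nearby, and the half-line is open. This identifies
  the unknown family behind a completely monotone function with an explicitly computed one.\<close>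

lemma alternating_derivs_unique:
  assumes G: "alternating_derivs G" and H: "alternating_derivs H"
    and eq: "\<And>t. 0 < t \<Longrightarrow> G 0 t = H 0 t" and "0 < t"
  shows "G n t = H n t"
  using \<open>0 < t\<close>
proof (induction n arbitrary: t)
  case (Suc n)
  have "(H n has_real_derivative - G (Suc n) t) (at t)"
    by (rule has_field_derivative_transform_within_open
          [OF alternating_derivsD[OF G Suc.prems], of "{0<..}"])
       (use Suc in auto)
  from DERIV_unique[OF this alternating_derivsD[OF H Suc.prems]] show ?case by simp
qed (use eq in auto)

text \<open>Taking the derivatives as data, with the signs built in, replaces iterated
  \<open>deriv\<close> by closed formulas: for dilates, quotients and series it suffices to name a
  family, check one derivative per index and check positivity.\<close>

lemma completely_monotone_iff_family:
  "completely_monotone h \<longleftrightarrow>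
     (\<exists>G. alternating_derivs G \<and> (\<forall>n. \<forall>t>0. 0 \<le> G n t) \<and> (\<forall>t>0. G 0 t = h t))"
  (is "_ \<longleftrightarrow> ?R")
proof
  assume cm: "completely_monotone h"
  define G where "G n t = (-1) ^ n * (deriv ^^ n) h t" for n t
  have "(G n has_real_derivative - G (Suc n) t) (at t)" if "0 < t" for n t
  proof -
    have "(deriv ^^ n) h differentiable (at t)"
      using cm that by (simp add: completely_monotone_def)
    then have "((deriv ^^ n) h has_real_derivative (deriv ^^ Suc n) h t) (at t)"
      by (simp add: DERIV_deriv_iff_real_differentiable)
    from DERIV_cmult[OF this, of "(-1) ^ n"] show ?thesis
      by (simp add: G_def[abs_def])
  qed
  with cm show ?R
    by (intro exI[of _ G]) (auto simp: alternating_derivs_def G_def completely_monotone_def)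
next
  assume ?R
  then obtain G where G: "alternating_derivs G" "\<And>n t. 0 < t \<Longrightarrow> 0 \<le> G n t"
    "\<And>t. 0 < t \<Longrightarrow> G 0 t = h t" by auto
  have eq: "(deriv ^^ n) h t = (-1) ^ n * G n t" if "0 < t" for n t
    using that
  proof (induction n arbitrary: t)
    case (Suc n)
    have "((\<lambda>t. (-1) ^ n * G n t) has_real_derivative (-1) ^ Suc n * G (Suc n) t) (at t)"
      using DERIV_cmult[OF alternating_derivsD[OF G(1) Suc.prems], of "(-1) ^ n"] by simp
    then have "((deriv ^^ n) h has_real_derivative (-1) ^ Suc n * G (Suc n) t) (at t)"
      by (rule has_field_derivative_transform_within_open[of _ _ _ "{0<..}"])
         (use Suc in auto)
    then show ?case by (simp add: DERIV_imp_deriv)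
  qed (use G in auto)
  show "completely_monotone h"
    unfolding completely_monotone_def
  proof (intro allI impI conjI)
    fix n and t :: real assume t: "0 < t"
    have "((\<lambda>t. (-1) ^ n * G n t) has_real_derivative (-1) ^ n * - G (Suc n) t) (at t)"
      by (rule DERIV_cmult[OF alternating_derivsD[OF G(1) t]])
    then have "((deriv ^^ n) h has_real_derivative (-1) ^ n * - G (Suc n) t) (at t)"
      by (rule has_field_derivative_transform_within_open[of _ _ _ "{0<..}"])
         (use t eq in auto)
    then show "(deriv ^^ n) h differentiable (at t)"
      using real_differentiable_def by blast
    show "0 \<le> (-1) ^ n * (deriv ^^ n) h t"
      using G(2)[OF t, of n] by (simp add: eq[OF t] flip: mult.assoc power_mult_distrib)
  qed
qed

lemma completely_monotoneE:
  assumes "completely_monotone h"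
  obtains G where "alternating_derivs G" "\<And>n t. 0 < t \<Longrightarrow> 0 \<le> G n t"
    "\<And>t. 0 < t \<Longrightarrow> G 0 t = h t"
  using assms unfolding completely_monotone_iff_family by blast

lemma completely_monotoneI:
  assumes "alternating_derivs G" "\<And>n t. 0 < t \<Longrightarrow> 0 \<le> G n t" "\<And>t. 0 < t \<Longrightarrow> G 0 t = h t"
  shows "completely_monotone h"
  using assms unfolding completely_monotone_iff_family by blast

lemma completely_monotone_cong:
  assumes "completely_monotone g" "\<And>t. 0 < t \<Longrightarrow> g t = h t"
  shows "completely_monotone h"
  using assms unfolding completely_monotone_iff_family by auto

lemma completely_monotone_nonneg: "completely_monotone h \<Longrightarrow> 0 < t \<Longrightarrow> 0 \<le> h t"
  by (metis completely_monotoneE)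

lemma completely_monotone_isCont:
  assumes "completely_monotone h" "0 < t"
  shows "isCont h t"
proof -
  have "(deriv ^^ 0) h differentiable (at t)"
    using assms unfolding completely_monotone_def by blast
  then show ?thesis
    by (simp add: differentiable_imp_continuous_within)
qed

lemma alternating_derivs_antimono:
  assumes G: "alternating_derivs G" and nn: "\<And>t. 0 < t \<Longrightarrow> 0 \<le> G (Suc n) t"
    and "0 < s" "s \<le> t"
  shows "G n t \<le> G n s"
proof (rule DERIV_nonpos_imp_nonincreasing[OF \<open>s \<le> t\<close>])
  fix x assume "s \<le> x" "x \<le> t"
  with \<open>0 < s\<close> have "0 < x" by simp
  with alternating_derivsD[OF G this, of n] nn[OF this]
  show "\<exists>y. (G n has_real_derivative y) (at x) \<and> y \<le> 0"
    by (intro exI[of _ "- G (Suc n) x"]) auto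
qed

lemma completely_monotone_antimono:
  assumes "completely_monotone h" "0 < s" "s \<le> t"
  shows "h t \<le> h s"
proof -
  obtain G where G: "alternating_derivs G" "\<And>n t. 0 < t \<Longrightarrow> 0 \<le> G n t"
    "\<And>t. 0 < t \<Longrightarrow> G 0 t = h t"
    using completely_monotoneE[OF assms(1)] by metis
  from alternating_derivs_antimono[OF G(1) G(2) assms(2,3), of 0] show ?thesis
    using G(3) assms(2,3) by simp
qed

lemma completely_monotone_scale:
  assumes "completely_monotone h" "0 < c" "0 \<le> d"
  shows "completely_monotone (\<lambda>t. d * h (c * t))"
proof -
  obtain G where G: "alternating_derivs G" "\<And>n t. 0 < t \<Longrightarrow> 0 \<le> G n t"
    "\<And>t. 0 < t \<Longrightarrow> G 0 t = h t"
    using completely_monotoneE[OF assms(1)] by metis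
  have "((\<lambda>t. d * (c ^ n * G n (c * t))) has_real_derivative
          - (d * (c ^ Suc n * G (Suc n) (c * t)))) (at t)" if "0 < t" for n t
    using DERIV_cmult[OF DERIV_chain2[OF alternating_derivsD[OF G(1), of "c * t" n]
          DERIV_cmult_Id[of c t]], of "d * c ^ n"] that assms(2)
    by (simp add: algebra_simps)
  then show ?thesis
    using assms G
    by (intro completely_monotoneI[of "\<lambda>n t. d * (c ^ n * G n (c * t))"])
       (auto simp: alternating_derivs_def)
qed

section \<open>Multiplication and division by t; the criterion through dilates\<close>

lemma alternating_derivs_times_id:
  assumes "alternating_derivs M"
  shows "alternating_derivs (\<lambda>n t. t * M n t - real n * M (n - 1) t)"
  unfolding alternating_derivs_def
proof (intro allI impI)
  fix n and t :: real assume t: "0 < t"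
  \<comment> \<open>At n = 0 the index \<open>n - 1\<close> is truncated to 0, which is harmless
    because the factor \<open>real n\<close> vanishes.\<close>
  have "((\<lambda>t. real n * M (n - 1) t) has_real_derivative - (real n * M n t)) (at t)"
  proof (cases n)
    case (Suc m)
    with DERIV_cmult[OF alternating_derivsD[OF assms t, of m], of "real n"] show ?thesis by simp
  qed simp
  from DERIV_diff[OF DERIV_mult[OF DERIV_ident alternating_derivsD[OF assms t, of n]] this]
  show "((\<lambda>t. t * M n t - real n * M (n - 1) t) has_real_derivative
      - (t * M (Suc n) t - real (Suc n) * M (Suc n - 1) t)) (at t)"
    by (simp add: algebra_simps)
qed

text \<open>The signed derivatives of g(t)/t. If D is this family, Leibniz's rule for t D(t) reads
  \<open>g n t = t * D n t - n * D (n - 1) t\<close>; the recursion solves it for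
  \<open>D n t\<close>.\<close>

primrec divided_derivs :: "(nat \<Rightarrow> real \<Rightarrow> real) \<Rightarrow> nat \<Rightarrow> real \<Rightarrow> real" where
  "divided_derivs g 0 t = g 0 t / t"
| "divided_derivs g (Suc n) t = (g (Suc n) t + real (Suc n) * divided_derivs g n t) / t"

lemma alternating_derivs_divided:
  assumes g: "alternating_derivs g"
  shows "alternating_derivs (divided_derivs g)"
  unfolding alternating_derivs_def
proof (intro allI impI)
  fix n and t :: real assume t: "0 < t"
  show "(divided_derivs g n has_real_derivative - divided_derivs g (Suc n) t) (at t)"
  proof (induction n)
    case 0
    have "divided_derivs g 0 = (\<lambda>t. g 0 t / t)" by (simp add: fun_eq_iff)
    moreover have "((\<lambda>t. g 0 t / t) has_real_derivative
        (- g (Suc 0) t * t - g 0 t * 1) / (t * t)) (at t)"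
      using t by (intro DERIV_divide alternating_derivsD[OF g] DERIV_ident) auto
    moreover have "(- g (Suc 0) t * t - g 0 t * 1) / (t * t) = - divided_derivs g (Suc 0) t"
      using t by (simp add: field_simps)
    ultimately show ?case by simp
  next
    case (Suc n)
    have "divided_derivs g (Suc n)
        = (\<lambda>t. (g (Suc n) t + real (Suc n) * divided_derivs g n t) / t)"
      by (simp add: fun_eq_iff)
    moreover have "((\<lambda>t. (g (Suc n) t + real (Suc n) * divided_derivs g n t) / t) has_real_derivative
        ((- g (Suc (Suc n)) t + real (Suc n) * - divided_derivs g (Suc n) t) * t
          - (g (Suc n) t + real (Suc n) * divided_derivs g n t) * 1) / (t * t)) (at t)"
      using t by (intro DERIV_divide DERIV_add DERIV_cmult alternating_derivsD[OF g] Suc DERIV_ident) auto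
    moreover have "((- g (Suc (Suc n)) t + real (Suc n) * - divided_derivs g (Suc n) t) * t
          - (g (Suc n) t + real (Suc n) * divided_derivs g n t) * 1) / (t * t)
        = - divided_derivs g (Suc (Suc n)) t"
    proof -
      \<comment> \<open>The second numerator is the previous quotient times t, so it adds one more
        copy of \<open>divided_derivs g (Suc n) t\<close> to the n + 1 copies already present; this
        gives the coefficient n + 2.\<close>
      have "g (Suc n) t + real (Suc n) * divided_derivs g n t = divided_derivs g (Suc n) t * t"
        using t by simp
      then show ?thesis
        using t by (simp only: divided_derivs.simps(2)[of g "Suc n"] of_nat_Suc) (simp add: field_simps)
    qed
    ultimately show ?case by metis
  qed
qed

text \<open>Repeated integration by parts of \<open>t\<^sup>n G\<^sub>n\<^sub>+\<^sub>1(t)\<close>.\<close>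

primrec moment_primitive :: "(nat \<Rightarrow> real \<Rightarrow> real) \<Rightarrow> nat \<Rightarrow> real \<Rightarrow> real" where
  "moment_primitive G 0 t = - G 0 t"
| "moment_primitive G (Suc n) t = real (Suc n) * moment_primitive G n t - t ^ Suc n * G (Suc n) t"

lemma moment_primitive_deriv:
  assumes G: "alternating_derivs G" and t: "0 < t"
  shows "(moment_primitive G n has_real_derivative t ^ n * G (Suc n) t) (at t)"
proof (induction n)
  case 0
  have "moment_primitive G 0 = (\<lambda>t. - G 0 t)" by (simp add: fun_eq_iff)
  then show ?case using DERIV_minus[OF alternating_derivsD[OF G t, of 0]] by simp
next
  case (Suc n)
  have "moment_primitive G (Suc n)
      = (\<lambda>t. real (Suc n) * moment_primitive G n t - t ^ Suc n * G (Suc n) t)"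
    by (simp add: fun_eq_iff)
  moreover have "((\<lambda>t. real (Suc n) * moment_primitive G n t - t ^ Suc n * G (Suc n) t)
      has_real_derivative real (Suc n) * (t ^ n * G (Suc n) t)
        - (real (Suc n) * t ^ n * G (Suc n) t + - G (Suc (Suc n)) t * t ^ Suc n)) (at t)"
    by (intro DERIV_diff DERIV_cmult DERIV_mult Suc alternating_derivsD[OF G t])
       (use DERIV_pow[of "Suc n" t] in simp)
  ultimately show ?case by (simp add: algebra_simps)
qed

lemma alternating_derivs_diff_scale:
  assumes G: "alternating_derivs G" and b: "0 < b"
  shows "alternating_derivs (\<lambda>n t. G n t - b ^ n * G n (b * t))"
  unfolding alternating_derivs_def
proof (intro allI impI)
  fix n and t :: real assume t: "0 < t"
  have "((\<lambda>t. G n (b * t)) has_real_derivative - G (Suc n) (b * t) * b) (at t)"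
    using DERIV_chain2[OF alternating_derivsD[OF G, of "b * t" n] DERIV_cmult_Id] b t by simp
  from DERIV_diff[OF alternating_derivsD[OF G t, of n] DERIV_cmult[OF this, of "b ^ n"]]
  show "((\<lambda>t. G n t - b ^ n * G n (b * t)) has_real_derivative
      - (G (Suc n) t - b ^ Suc n * G (Suc n) (b * t))) (at t)"
    by (simp add: algebra_simps)
qed

text \<open>Both sides satisfy \<open>a (n + 1) = (n + 1) * a n + t ^ (n + 1) * g (n + 1) t\<close>,
  where g is the family of k(t) - k(b t): the chain rule factor \<open>b ^ n\<close> merges with
  \<open>t ^ n\<close> into \<open>(b * t) ^ n\<close>. The sign of a derivative thereby becomes a
  comparison of two values of one function.\<close>

lemma divided_derivs_eq_primitive:
  assumes t: "0 < t"
  shows "t ^ Suc n * divided_derivs (\<lambda>n t. G n t - b ^ n * G n (b * t)) n t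
     = moment_primitive G n (b * t) - moment_primitive G n t"
proof (induction n)
  case (Suc n)
  let ?D = "divided_derivs (\<lambda>n t. G n t - b ^ n * G n (b * t))"
  have "t ^ Suc (Suc n) * ?D (Suc n) t
      = t ^ Suc n * (G (Suc n) t - b ^ Suc n * G (Suc n) (b * t)) + real (Suc n) * (t ^ Suc n * ?D n t)"
    using t by (simp add: field_simps)
  also have "\<dots> = moment_primitive G (Suc n) (b * t) - moment_primitive G (Suc n) t"
    unfolding Suc by (simp add: algebra_simps power_mult_distrib)
  finally show ?case .
qed (use t in simp)

lemma completely_monotone_scale_quotient:
  assumes k: "completely_monotone k" and b: "1 \<le> b"
  shows "completely_monotone (\<lambda>t. (k t - k (b * t)) / t)"
proof -
  obtain G where G: "alternating_derivs G" "\<And>n t. 0 < t \<Longrightarrow> 0 \<le> G n t"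
    "\<And>t. 0 < t \<Longrightarrow> G 0 t = k t"
    using completely_monotoneE[OF k] by metis
  let ?g = "\<lambda>n t. G n t - b ^ n * G n (b * t)"
  show ?thesis
  proof (rule completely_monotoneI[of "divided_derivs ?g"])
    show "alternating_derivs (divided_derivs ?g)"
      using G(1) b by (intro alternating_derivs_divided alternating_derivs_diff_scale) auto
    fix t :: real assume t: "0 < t"
    show "divided_derivs ?g 0 t = (k t - k (b * t)) / t"
      using G(3) t b by simp
    fix n
    have "moment_primitive G n t \<le> moment_primitive G n (b * t)"
    proof (rule DERIV_nonneg_imp_nondecreasing[where f = "moment_primitive G n"])
      show "t \<le> b * t" using b t by simp
      fix x assume "t \<le> x"
      with t have x: "0 < x" by simp
      with moment_primitive_deriv[OF G(1) x] G(2)[OF x]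
      show "\<exists>y. (moment_primitive G n has_real_derivative y) (at x) \<and> 0 \<le> y"
        by (intro exI[of _ "x ^ n * G (Suc n) x"]) auto
    qed
    then have "0 \<le> t ^ Suc n * divided_derivs ?g n t"
      unfolding divided_derivs_eq_primitive[OF t] by simp
    then show "0 \<le> divided_derivs ?g n t"
      using zero_less_power[OF t, of "Suc n"] by (simp only: zero_le_mult_iff) auto
  qed
qed

text \<open>Any x < y can be written as y = b x with b > 1, so positivity for all b makes every
  \<open>moment_primitive G n\<close> nondecreasing. Its derivative
  \<open>t ^ n * G (Suc n) t\<close> is then nonnegative; only the sign of \<open>G 0\<close> has to
  be assumed.\<close>

lemma completely_monotone_from_scale_quotients:
  assumes G: "alternating_derivs G" and nn: "\<And>t. 0 < t \<Longrightarrow> 0 \<le> G 0 t"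
    and q: "\<And>b. 1 < b \<Longrightarrow> completely_monotone (\<lambda>t. (G 0 t - G 0 (b * t)) / t)"
  shows "completely_monotone (G 0)"
proof (rule completely_monotoneI[OF G])
  fix n and t :: real assume t: "0 < t"
  show "0 \<le> G n t"
  proof (cases n)
    case (Suc n')
    have mono: "moment_primitive G n' x \<le> moment_primitive G n' y" if "0 < x" "x < y" for x y
    proof -
      define b where "b = y / x"
      have b: "1 < b" "y = b * x" using that by (auto simp: b_def)
      let ?g = "\<lambda>n t. G n t - b ^ n * G n (b * t)"
      obtain L where L: "alternating_derivs L" "\<And>n t. 0 < t \<Longrightarrow> 0 \<le> L n t"
        "\<And>t. 0 < t \<Longrightarrow> L 0 t = (G 0 t - G 0 (b * t)) / t"
        using completely_monotoneE[OF q[OF b(1)]] by metis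
      have "alternating_derivs (divided_derivs ?g)"
        using G b by (intro alternating_derivs_divided alternating_derivs_diff_scale) auto
      from alternating_derivs_unique[OF L(1) this, of x n'] L(2)[OF that(1), of n'] L(3) that(1)
      have "0 \<le> divided_derivs ?g n' x" by simp
      then have "0 \<le> x ^ Suc n' * divided_derivs ?g n' x" using that(1) by simp
      then show ?thesis
        unfolding divided_derivs_eq_primitive[OF that(1)] b(2) by simp
    qed
    have "0 \<le> t ^ n' * G (Suc n') t"
    proof (rule ccontr)
      assume "\<not> 0 \<le> t ^ n' * G (Suc n') t"
      then obtain d where d: "0 < d" "\<And>h. 0 < h \<Longrightarrow> h < d \<Longrightarrow>
          moment_primitive G n' (t + h) < moment_primitive G n' t"
        using DERIV_neg_dec_right[OF moment_primitive_deriv[OF G t, of n']] by auto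
      from d(2)[of "d / 2"] mono[of t "t + d / 2"] d(1) t show False by simp
    qed
    then show ?thesis using zero_less_power[OF t, of n'] Suc by (simp add: zero_le_mult_iff)
  qed (use nn t in simp)
qed simp

text \<open>Pointwise convergence suffices because each signed derivative is nonnegative and
  nonincreasing: the mean value theorem on [t/2, t] bounds \<open>G j (Suc n) t\<close> by
  \<open>2 / t * G j n (t / 2)\<close>, so summability passes from each derivative to the
  next.\<close>

lemma completely_monotone_suminf:
  assumes cm: "\<And>j::nat. completely_monotone (h j)"
    and sm: "\<And>t. 0 < t \<Longrightarrow> summable (\<lambda>j. h j t)"
  shows "completely_monotone (\<lambda>t. \<Sum>j. h j t)"
proof -
  have "\<forall>j. \<exists>G. alternating_derivs G \<and> (\<forall>n. \<forall>t>0. 0 \<le> G n t) \<and> (\<forall>t>0. G 0 t = h j t)"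
    using cm unfolding completely_monotone_iff_family by blast
  then obtain G where G: "\<And>j. alternating_derivs (G j)" "\<And>j n t. 0 < t \<Longrightarrow> 0 \<le> G j n t"
    "\<And>j t. 0 < t \<Longrightarrow> G j 0 t = h j t" by metis
  have anti: "G j n t \<le> G j n s" if "0 < s" "s \<le> t" for j n s t
    using alternating_derivs_antimono[OF G(1) G(2) that] .
  have bound: "G j (Suc n) t \<le> 2 / t * G j n (t / 2)" if t: "0 < t" for j n t
  proof -
    obtain z where z: "t / 2 < z" "z < t" "G j n t - G j n (t / 2) = (t - t / 2) * - G j (Suc n) z"
      using MVT2[of "t / 2" t "G j n" "\<lambda>x. - G j (Suc n) x"] alternating_derivsD[OF G(1), of _ j n] t
      by auto
    then have "t / 2 * G j (Suc n) z = G j n (t / 2) - G j n t" by (simp add: algebra_simps)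
    moreover have "t / 2 * G j (Suc n) t \<le> t / 2 * G j (Suc n) z"
      using anti[of z t j "Suc n"] z t by (intro mult_left_mono) auto
    moreover have "0 \<le> G j n t" using G(2) t by blast
    ultimately have "t / 2 * G j (Suc n) t \<le> G j n (t / 2)" by linarith
    then show ?thesis using t by (simp add: field_simps)
  qed
  have summ: "summable (\<lambda>j. G j n t)" if "0 < t" for n t
    using that
  proof (induction n arbitrary: t)
    case (Suc n)
    show ?case
    proof (rule summable_comparison_test')
      show "summable (\<lambda>j. 2 / t * G j n (t / 2))"
        using Suc by (intro summable_mult) auto
      show "norm (G j (Suc n) t) \<le> 2 / t * G j n (t / 2)" if "0 \<le> j" for j
        using bound[OF Suc.prems] G(2)[OF Suc.prems] by simp
    qed
  qed (use sm G(3) in simp)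
  have deriv: "((\<lambda>t. \<Sum>j. G j n t) has_real_derivative (\<Sum>j. - G j (Suc n) t)) (at t)"
    if t: "0 < t" for n t
  proof -
    \<comment> \<open>On this half-line, which has t in its interior, monotonicity makes the values
      at t/2 a summable majorant.\<close>
    have unif: "uniformly_convergent_on {t / 2..} (\<lambda>n' x. \<Sum>j<n'. - G j (Suc n) x)"
    proof (rule Weierstrass_m_test'[where M = "\<lambda>j. G j (Suc n) (t / 2)"])
      fix j x assume "x \<in> {t / 2..}"
      then show "norm (- G j (Suc n) x) \<le> G j (Suc n) (t / 2)"
        using t anti[of "t / 2" x j "Suc n"] G(2)[of x j "Suc n"] by auto
    qed (use summ[of "t / 2" "Suc n"] t in simp)
    have within: "(G j n has_real_derivative - G j (Suc n) x) (at x within {t / 2..})"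
      if "x \<in> {t / 2..}" for j x
    proof (rule has_field_derivative_at_within)
      have "0 < x" using that t by simp
      then show "(G j n has_real_derivative - G j (Suc n) x) (at x)"
        by (rule alternating_derivsD[OF G(1)])
    qed
    have "t \<in> {t / 2..}" "t \<in> interior {t / 2..}"
      using t by (auto simp: interior_real_atLeast)
    then show ?thesis
      using has_field_derivative_series'(2)[OF convex_real_interval(1) within unif _ summ[OF t]]
      by blast
  qed
  show ?thesis
  proof (rule completely_monotoneI[of "\<lambda>n t. \<Sum>j. G j n t"])
    show "alternating_derivs (\<lambda>n t. \<Sum>j. G j n t)"
      unfolding alternating_derivs_def using deriv summ by (simp add: suminf_minus)
  qed (use summ G in \<open>auto intro: suminf_nonneg\<close>)
qed

subsection \<open>Laplace transforms of laws on the half-line\<close>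

text \<open>Uniqueness in the Hausdorff moment problem: \<open>exp (- x)\<close> maps the half-line
  into [0, 1], the integrals in \<open>eq\<close> are the moments of the image measures, and
  polynomials are uniformly dense in the continuous functions on [0, 1].\<close>

lemma integral_exp_continuous_eq:
  fixes M N :: "real measure" and g :: "real \<Rightarrow> real"
  assumes M: "finite_measure M" "sets M = sets borel" "AE x in M. 0 \<le> x"
    and N: "finite_measure N" "sets N = sets borel" "AE x in N. 0 \<le> x"
    and eq: "\<And>n::nat. (\<integral>x. exp (- real n * x) \<partial>M) = (\<integral>x. exp (- real n * x) \<partial>N)"
    and g: "continuous_on UNIV g"
  shows "(\<integral>x. g (exp (- x)) \<partial>M) = (\<integral>x. g (exp (- x)) \<partial>N)"
proof -
  have gm[measurable]: "g \<in> borel_measurable borel"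
    using g by (rule borel_measurable_continuous_onI)
  have "compact (g ` {0..1})"
    using g by (intro compact_continuous_image continuous_on_subset[OF g]) auto
  then obtain B where B: "\<And>x. x \<in> {0..1} \<Longrightarrow> \<bar>g x\<bar> \<le> B"
    using compact_imp_bounded[of "g ` {0..1}"] unfolding bounded_iff by fastforce
  have approx: "\<bar>(\<integral>x. g (exp (- x)) \<partial>L) - (\<Sum>i\<le>n. a i * (\<integral>x. exp (- real i * x) \<partial>L))\<bar>
      \<le> e * measure L (space L)"
    if L: "finite_measure L" "sets L = sets borel" "AE x in L. 0 \<le> x"
      and p: "\<And>x. x \<in> {0..1} \<Longrightarrow> \<bar>g x - (\<Sum>i\<le>n. a i * x ^ i)\<bar> < e"
    for L :: "real measure" and n and a :: "nat \<Rightarrow> real" and e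
  proof -
    interpret finite_measure L by fact
    note L(2)[measurable_cong]
    have ig: "integrable L (\<lambda>x. g (exp (- x)))"
    proof (rule integrable_const_bound[of _ B])
      show "AE x in L. norm (g (exp (- x))) \<le> B"
        using L(3) by eventually_elim (use B in auto)
    qed measurable
    have ie: "integrable L (\<lambda>x. exp (- real i * x))" for i :: nat
    proof (rule integrable_const_bound[of _ 1])
      show "AE x in L. norm (exp (- real i * x)) \<le> 1"
        using L(3) by eventually_elim auto
    qed measurable
    have pow: "exp (- x) ^ i = exp (- real i * x)" for x :: real and i
      by (simp flip: exp_of_nat_mult)
    have ip: "integrable L (\<lambda>x. g (exp (- x)) - (\<Sum>i\<le>n. a i * exp (- x) ^ i))"
      unfolding pow by (intro Bochner_Integration.integrable_diff ig Bochner_Integration.integrable_sum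
          integrable_mult_right ie)
    have "(\<integral>x. g (exp (- x)) \<partial>L) - (\<Sum>i\<le>n. a i * (\<integral>x. exp (- real i * x) \<partial>L))
        = (\<integral>x. g (exp (- x)) - (\<Sum>i\<le>n. a i * exp (- x) ^ i) \<partial>L)"
      unfolding pow using ig ie
      by (simp add: Bochner_Integration.integral_diff Bochner_Integration.integral_sum)
    also have "\<bar>\<dots>\<bar> \<le> (\<integral>x. e \<partial>L)"
    proof (rule order_trans[OF integral_abs_bound])
      show "(\<integral>x. \<bar>g (exp (- x)) - (\<Sum>i\<le>n. a i * exp (- x) ^ i)\<bar> \<partial>L) \<le> (\<integral>x. e \<partial>L)"
      proof (rule integral_mono_AE)
        show "AE x in L. \<bar>g (exp (- x)) - (\<Sum>i\<le>n. a i * exp (- x) ^ i)\<bar> \<le> e"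
          using L(3) by eventually_elim (use p in \<open>auto intro!: less_imp_le\<close>)
      qed (use ip in auto)
    qed
    finally show ?thesis by (simp add: mult.commute)
  qed
  define m where "m = measure M (space M) + measure N (space N)"
  have m: "0 \<le> m" by (simp add: m_def)
  have small: "\<bar>(\<integral>x. g (exp (- x)) \<partial>M) - (\<integral>x. g (exp (- x)) \<partial>N)\<bar> \<le> e * m" if "0 < e" for e
  proof -
    obtain p where p: "real_polynomial_function p" "\<And>x. x \<in> {0..1} \<Longrightarrow> \<bar>g x - p x\<bar> < e"
      using Stone_Weierstrass_real_polynomial_function[of "{0..1::real}" g e] g \<open>0 < e\<close>
        continuous_on_subset by blast
    then obtain a n where an: "p = (\<lambda>x. \<Sum>i\<le>n. a i * x ^ i)"
      unfolding real_polynomial_function_iff_sum by blast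
    have "\<bar>(\<integral>x. g (exp (- x)) \<partial>M) - (\<integral>x. g (exp (- x)) \<partial>N)\<bar>
        \<le> e * measure M (space M) + e * measure N (space N)"
      using approx[OF M, where n = n and a = a and e = e]
        approx[OF N, where n = n and a = a and e = e] p(2) unfolding an eq by force
    then show ?thesis by (simp add: m_def distrib_left)
  qed
  show ?thesis
  proof (rule ccontr)
    assume "\<not> ?thesis"
    then have d: "0 < \<bar>(\<integral>x. g (exp (- x)) \<partial>M) - (\<integral>x. g (exp (- x)) \<partial>N)\<bar>" (is "0 < ?d") by simp
    \<comment> \<open>This tolerance makes the error at most half of \<open>?d\<close>; the summand
      1 avoids dividing by zero when both measures vanish.\<close>
    have "?d \<le> ?d / (2 * (m + 1)) * m"
      using d m by (intro small divide_pos_pos) auto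
    also have "\<dots> \<le> ?d / 2"
      using d m by (simp add: field_simps)
    finally show False using d by simp
  qed
qed

lemma finite_measure_laplace_unique:
  fixes M N :: "real measure"
  assumes M: "finite_measure M" "sets M = sets borel" "AE x in M. 0 \<le> x"
    and N: "finite_measure N" "sets N = sets borel" "AE x in N. 0 \<le> x"
    and eq: "\<And>n::nat. (\<integral>x. exp (- real n * x) \<partial>M) = (\<integral>x. exp (- real n * x) \<partial>N)"
  shows "M = N"
proof (rule cdf_unique')
  show fM: "finite_borel_measure M" and fN: "finite_borel_measure N"
    using M N by (auto simp: finite_borel_measure_def finite_borel_measure_axioms_def)
  show "cdf M = cdf N"
  proof
    fix y :: real
    \<comment> \<open>Continuous ramps tending to the indicator of \<open>w \<ge> exp (- y)\<close>.
      At \<open>w = exp (- x)\<close> this is the indicator of \<open>x \<le> y\<close>, so their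
      integrals tend to the distribution function at y.\<close>
    define g where "g n w = max 0 (min 1 (1 + real n * (w - exp (- y))))" for n w
    have lim: "(\<lambda>n. \<integral>x. g n (exp (- x)) \<partial>L) \<longlonglongrightarrow> cdf L y" if fL: "finite_borel_measure L" for L
    proof -
      interpret finite_borel_measure L by fact
      note M_is_borel[measurable_cong]
      have "(\<lambda>n. \<integral>x. g n (exp (- x)) \<partial>L) \<longlonglongrightarrow> (\<integral>x. indicator {..y} x \<partial>L)"
      proof (rule integral_dominated_convergence[where w = "\<lambda>_. 1"])
        show "AE x in L. (\<lambda>n. g n (exp (- x))) \<longlonglongrightarrow> indicator {..y} x"
        proof (rule AE_I2)
          fix x
          show "(\<lambda>n. g n (exp (- x))) \<longlonglongrightarrow> indicator {..y} x"
          proof (cases "x \<le> y")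
            case True
            then show ?thesis by (simp add: g_def)
          next
            case False
            define d where "d = exp (- y) - exp (- x)"
            have d: "0 < d" using False by (simp add: d_def)
            obtain n0 :: nat where n0: "1 / d < real n0" using reals_Archimedean2 by blast
            have "g n (exp (- x)) = 0" if "n0 \<le> n" for n
            proof -
              have "1 < real n0 * d" using n0 d by (simp add: field_simps)
              also have "\<dots> \<le> real n * d" using that d by (intro mult_right_mono) auto
              finally have "1 + real n * (exp (- x) - exp (- y)) \<le> 0"
                by (simp add: d_def algebra_simps)
              then show ?thesis by (simp add: g_def)
            qed
            then have "\<forall>\<^sub>F n in sequentially. g n (exp (- x)) = 0"
              unfolding eventually_sequentially by blast
            then show ?thesis using False by (simp add: tendsto_eventually)
          qed
        qed
        show "(\<lambda>x. g n (exp (- x))) \<in> borel_measurable L" for n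
          unfolding g_def by measurable
      qed (auto simp: g_def)
      then show ?thesis by (simp add: cdf_def)
    qed
    have "(\<integral>x. g n (exp (- x)) \<partial>M) = (\<integral>x. g n (exp (- x)) \<partial>N)" for n
      by (rule integral_exp_continuous_eq[OF M N eq]) (auto simp: g_def intro!: continuous_intros)
    with lim[OF fM] lim[OF fN] show "cdf M y = cdf N y"
      using LIMSEQ_unique by simp
  qed
qed

section \<open>Laplace exponents under dilation and convolution\<close>

lemma nonneg_law_real_distribution: "nonneg_law \<mu> \<Longrightarrow> real_distribution \<mu>"
  and nonneg_law_AE: "nonneg_law \<mu> \<Longrightarrow> AE x in \<mu>. 0 \<le> x"
  by (auto simp: nonneg_law_def)

lemma nonneg_law_integrable_exp:
  assumes "nonneg_law \<mu>" "0 \<le> u"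
  shows "integrable \<mu> (\<lambda>x. exp (- u * x))"
proof -
  interpret real_distribution \<mu> by (rule nonneg_law_real_distribution[OF assms(1)])
  show ?thesis
  proof (rule integrable_const_bound[of _ 1])
    show "AE x in \<mu>. norm (exp (- u * x)) \<le> 1"
      using nonneg_law_AE[OF assms(1)] by eventually_elim (use assms(2) in auto)
  qed measurable
qed

lemma set_integral_exp_eq:
  assumes "nonneg_law \<mu>"
  shows "(LINT x:{0..}|\<mu>. exp (- u * x)) = (\<integral>x. exp (- u * x) \<partial>\<mu>)"
proof -
  interpret real_distribution \<mu> by (rule nonneg_law_real_distribution[OF assms])
  show ?thesis
    unfolding set_lebesgue_integral_def
    by (rule integral_cong_AE) (use nonneg_law_AE[OF assms] in \<open>auto elim: AE_mp\<close>)
qed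

lemma laplace_transform_eq_exponent:
  assumes "nonneg_law \<mu>" "0 \<le> u"
  shows "(\<integral>x. exp (- u * x) \<partial>\<mu>) = exp (- laplace_exponent \<mu> u)"
  using laplace_exponent[OF assms] set_integral_exp_eq[OF assms(1)] by simp

lemma laplace_exponent_eqI:
  assumes "nonneg_law \<mu>" "(\<integral>x. exp (- u * x) \<partial>\<mu>) = exp (- p)"
  shows "laplace_exponent \<mu> u = p"
  unfolding laplace_exponent_def set_integral_exp_eq[OF assms(1)] assms(2) by simp

lemma nonneg_law_eqI:
  assumes \<mu>: "nonneg_law \<mu>" and \<nu>: "nonneg_law \<nu>"
    and eq: "\<And>u. 0 \<le> u \<Longrightarrow> laplace_exponent \<mu> u = laplace_exponent \<nu> u"
  shows "\<mu> = \<nu>"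
proof -
  interpret M: real_distribution \<mu> by (rule nonneg_law_real_distribution[OF \<mu>])
  interpret N: real_distribution \<nu> by (rule nonneg_law_real_distribution[OF \<nu>])
  show ?thesis
  proof (rule finite_measure_laplace_unique)
    fix n :: nat
    show "(\<integral>x. exp (- real n * x) \<partial>\<mu>) = (\<integral>x. exp (- real n * x) \<partial>\<nu>)"
      using laplace_transform_eq_exponent[OF \<mu>, of "real n"]
        laplace_transform_eq_exponent[OF \<nu>, of "real n"] eq[of "real n"] by simp
  qed (use \<mu> \<nu> in \<open>auto intro: M.finite_measure_axioms N.finite_measure_axioms
        dest: nonneg_law_AE\<close>)
qed

lemma nonneg_law_return:
  assumes "0 \<le> a"
  shows "nonneg_law (return borel a)" "laplace_exponent (return borel a) u = a * u"
proof -
  show nn: "nonneg_law (return borel a)"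
    using assms
    by (auto simp: nonneg_law_def real_distribution_def real_distribution_axioms_def
        AE_return intro: prob_space_return)
  show "laplace_exponent (return borel a) u = a * u"
    by (rule laplace_exponent_eqI[OF nn]) (simp add: integral_return mult.commute)
qed

lemma nonneg_law_scale:
  assumes \<mu>: "nonneg_law \<mu>" and c: "0 \<le> c"
  shows "nonneg_law (distr \<mu> borel (\<lambda>x. c * x))"
    and "0 \<le> u \<Longrightarrow> laplace_exponent (distr \<mu> borel (\<lambda>x. c * x)) u = laplace_exponent \<mu> (c * u)"
proof -
  interpret real_distribution \<mu> by (rule nonneg_law_real_distribution[OF \<mu>])
  have "AE x in \<mu>. 0 \<le> c * x"
    using nonneg_law_AE[OF \<mu>] by eventually_elim (use c in auto)
  then show nn: "nonneg_law (distr \<mu> borel (\<lambda>x. c * x))"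
    by (simp add: nonneg_law_def AE_distr_iff)
  show "laplace_exponent (distr \<mu> borel (\<lambda>x. c * x)) u = laplace_exponent \<mu> (c * u)" if "0 \<le> u"
    using laplace_transform_eq_exponent[OF \<mu>, of "c * u"] c that
    by (intro laplace_exponent_eqI[OF nn]) (simp add: integral_distr mult_ac)
qed

lemma real_distribution_convolution:
  assumes "real_distribution \<mu>" "real_distribution \<nu>"
  shows "real_distribution (\<mu> \<star> \<nu>)"
proof -
  interpret M: real_distribution \<mu> by fact
  interpret N: real_distribution \<nu> by fact
  interpret pair_prob_space \<mu> \<nu> ..
  show ?thesis unfolding convolution_def by (rule real_distribution_distr) measurable
qed

lemma integral_exp_convolution:
  assumes "real_distribution \<mu>" "real_distribution \<nu>"
    and "integrable \<mu> (\<lambda>x. exp (- u * x))" "integrable \<nu> (\<lambda>x. exp (- u * x))"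
  shows "(\<integral>x. exp (- u * x) \<partial>(\<mu> \<star> \<nu>)) = (\<integral>x. exp (- u * x) \<partial>\<mu>) * (\<integral>x. exp (- u * x) \<partial>\<nu>)"
proof -
  interpret M: real_distribution \<mu> by fact
  interpret N: real_distribution \<nu> by fact
  interpret pair_prob_space \<mu> \<nu> ..
  have int: "integrable (\<mu> \<Otimes>\<^sub>M \<nu>) (\<lambda>(x, y). exp (- u * x) * exp (- u * y))"
    using assms(3,4) by (intro Fubini_integrable) auto
  have "(\<integral>x. exp (- u * x) \<partial>(\<mu> \<star> \<nu>)) = (\<integral>z. (case z of (x, y) \<Rightarrow> exp (- u * x) * exp (- u * y)) \<partial>(\<mu> \<Otimes>\<^sub>M \<nu>))"
    unfolding convolution_def
    by (subst integral_distr) (auto simp: case_prod_beta distrib_left exp_add exp_diff exp_minus field_simps intro!: Bochner_Integration.integral_cong)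
  also have "\<dots> = (\<integral>x. \<integral>y. exp (- u * x) * exp (- u * y) \<partial>\<nu> \<partial>\<mu>)"
    using integral_fst'[OF int] by simp
  finally show ?thesis by simp
qed

lemma nonneg_law_convolution:
  assumes \<mu>: "nonneg_law \<mu>" and \<nu>: "nonneg_law \<nu>"
  shows "nonneg_law (\<mu> \<star> \<nu>)"
    and "0 \<le> u \<Longrightarrow> laplace_exponent (\<mu> \<star> \<nu>) u = laplace_exponent \<mu> u + laplace_exponent \<nu> u"
proof -
  note rd = nonneg_law_real_distribution[OF \<mu>] nonneg_law_real_distribution[OF \<nu>]
  interpret M: real_distribution \<mu> by (rule rd)
  interpret N: real_distribution \<nu> by (rule rd)
  interpret pair_prob_space \<mu> \<nu> ..
  have ae: "AE x in \<mu>. AE y in \<nu>. 0 \<le> x + y"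
    using nonneg_law_AE[OF \<mu>]
  proof eventually_elim
    case (elim x)
    show ?case using nonneg_law_AE[OF \<nu>] by eventually_elim (use elim in simp)
  qed
  have meas: "{z \<in> space (\<mu> \<Otimes>\<^sub>M \<nu>). 0 \<le> fst z + snd z} \<in> sets (\<mu> \<Otimes>\<^sub>M \<nu>)"
    by measurable
  from ae have "AE z in \<mu> \<Otimes>\<^sub>M \<nu>. 0 \<le> fst z + snd z"
    by (intro AE_pair_measure meas) simp
  then show nn: "nonneg_law (\<mu> \<star> \<nu>)"
    using real_distribution_convolution[OF rd]
    by (simp add: nonneg_law_def convolution_def AE_distr_iff case_prod_beta)
  show "laplace_exponent (\<mu> \<star> \<nu>) u = laplace_exponent \<mu> u + laplace_exponent \<nu> u" if "0 \<le> u"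
    using integral_exp_convolution[OF rd nonneg_law_integrable_exp[OF \<mu> that]
        nonneg_law_integrable_exp[OF \<nu> that]]
      laplace_transform_eq_exponent[OF \<mu> that] laplace_transform_eq_exponent[OF \<nu> that]
    by (intro laplace_exponent_eqI[OF nn]) (simp flip: exp_add)
qed

lemma nonneg_law_convolution_power:
  assumes \<mu>: "nonneg_law \<mu>"
  shows "\<exists>\<nu>. nonneg_law \<nu> \<and> (\<forall>u\<ge>0. laplace_exponent \<nu> u = real n * laplace_exponent \<mu> u)"
proof (induction n)
  case 0
  show ?case using nonneg_law_return[of 0] by auto
next
  case (Suc n)
  then obtain \<nu> where "nonneg_law \<nu>" "\<forall>u\<ge>0. laplace_exponent \<nu> u = real n * laplace_exponent \<mu> u"
    by blast
  with nonneg_law_convolution[OF \<mu>, of \<nu>] show ?case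
    by (intro exI[of _ "\<mu> \<star> \<nu>"]) (auto simp: algebra_simps)
qed

subsection \<open>Levy densities\<close>

definition levy_density :: "(real \<Rightarrow> real) \<Rightarrow> bool" where
  "levy_density m \<longleftrightarrow> (\<forall>t>0. 0 \<le> m t) \<and> set_integrable lborel {0<..} (\<lambda>t. min 1 t * m t)"

definition levy_integral :: "(real \<Rightarrow> real) \<Rightarrow> real \<Rightarrow> real" where
  "levy_integral m u = (LINT t:{0<..}|lborel. (1 - exp (- u * t)) * m t)"

lemma exponent_form_iff_levy:
  "exponent_form \<psi> a k \<longleftrightarrow>
     0 \<le> a \<and> levy_density (\<lambda>t. k t / t) \<and> (\<forall>u\<ge>0. \<psi> u = a * u + levy_integral (\<lambda>t. k t / t) u)"
  unfolding exponent_form_def levy_density_def levy_integral_def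
  by (auto simp: zero_le_divide_iff)

lemma levy_density_nonneg: "levy_density m \<Longrightarrow> 0 < t \<Longrightarrow> 0 \<le> m t"
  by (simp add: levy_density_def)

text \<open>Measurability is hidden in the integrability clause; it is recovered by dividing out
  \<open>min 1 t\<close>, which is positive wherever the indicator is nonzero.\<close>

lemma levy_density_measurable:
  assumes "levy_density m"
  shows "(\<lambda>t. indicator {0<..} t * m t) \<in> borel_measurable borel"
proof -
  have "(\<lambda>t. indicator {0<..} t *\<^sub>R (min 1 t * m t)) \<in> borel_measurable borel"
    using assms unfolding levy_density_def set_integrable_def
    by (auto dest: borel_measurable_integrable)
  then have "(\<lambda>t. inverse (min 1 t) * (indicator {0<..} t *\<^sub>R (min 1 t * m t))) \<in> borel_measurable borel"
    by measurable
  also have "(\<lambda>t. inverse (min 1 t) * (indicator {0<..} t *\<^sub>R (min 1 t * m t)))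
      = (\<lambda>t. indicator {0<..} t * m t)"
    by (auto simp: fun_eq_iff min_def split: split_indicator)
  finally show ?thesis .
qed

lemma levy_integrand_bound:
  assumes "0 \<le> u" "0 < t"
  shows "0 \<le> 1 - exp (- u * t)" "1 - exp (- u * t) \<le> max 1 u * min 1 (t::real)"
proof -
  show "0 \<le> 1 - exp (- u * t)" using assms by simp
  have "1 - exp (- u * t) \<le> u * t"
    using exp_ge_add_one_self[of "- u * t"] by simp
  moreover have "u * t \<le> max 1 u * t" using assms by (intro mult_right_mono) auto
  ultimately show "1 - exp (- u * t) \<le> max 1 u * min 1 t"
    by (smt (verit) exp_gt_zero mult_cancel_left2)
qed

lemma set_integrable_bound_lborel:
  fixes f g :: "real \<Rightarrow> real"
  assumes f: "set_integrable lborel {0<..} f"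
    and g: "(\<lambda>t. indicator {0<..} t * g t) \<in> borel_measurable borel"
    and le: "\<And>t. 0 < t \<Longrightarrow> \<bar>g t\<bar> \<le> f t"
  shows "set_integrable lborel {0<..} g"
  unfolding set_integrable_def
proof (rule Bochner_Integration.integrable_bound)
  show "integrable lborel (\<lambda>t. indicator {0<..} t *\<^sub>R f t)"
    using f by (simp add: set_integrable_def)
  show "(\<lambda>t. indicator {0<..} t *\<^sub>R g t) \<in> borel_measurable lborel" using g by simp
  show "AE t in lborel. norm (indicator {0<..} t *\<^sub>R g t) \<le> norm (indicator {0<..} t *\<^sub>R f t)"
    using le by (intro AE_I2) (auto split: split_indicator intro: order_trans[OF le abs_ge_self])
qed

lemma levy_measurable_mult:
  assumes "levy_density m" and [measurable]: "f \<in> borel_measurable borel"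
  shows "(\<lambda>t. indicator {0<..} t * (f t * m t)) \<in> borel_measurable borel"
proof -
  note levy_density_measurable[OF assms(1), measurable]
  have "(\<lambda>t. f t * (indicator {0<..} t * m t)) \<in> borel_measurable borel" by measurable
  then show ?thesis by (simp add: mult.left_commute)
qed

lemma levy_integrable:
  assumes "levy_density m" "0 \<le> u"
  shows "set_integrable lborel {0<..} (\<lambda>t. (1 - exp (- u * t)) * m t)"
proof (rule set_integrable_bound_lborel)
  show "set_integrable lborel {0<..} (\<lambda>t. max 1 u * (min 1 t * m t))"
    using assms(1) by (intro set_integrable_mult_right) (simp add: levy_density_def)
  show "(\<lambda>t. indicator {0<..} t * ((1 - exp (- u * t)) * m t)) \<in> borel_measurable borel"
    by (rule levy_measurable_mult[OF assms(1)]) measurable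
  fix t :: real assume t: "0 < t"
  have "(1 - exp (- u * t)) * m t \<le> max 1 u * min 1 t * m t"
    using levy_integrand_bound[OF assms(2) t] levy_density_nonneg[OF assms(1) t]
    by (intro mult_right_mono) auto
  then show "\<bar>(1 - exp (- u * t)) * m t\<bar> \<le> max 1 u * (min 1 t * m t)"
    using levy_integrand_bound[OF assms(2) t] levy_density_nonneg[OF assms(1) t]
    by (simp add: abs_mult mult.assoc)
qed

text \<open>Integrability of the integrand at u = 1 is enough, because
  \<open>1 - exp (- t) \<ge> t / (1 + t) \<ge> min 1 t / 2\<close>. Dilates and series of densities
  are recognised as Levy densities in this way.\<close>

lemma levy_densityI:
  assumes nn: "\<And>t. 0 < t \<Longrightarrow> 0 \<le> m t"
    and int: "set_integrable lborel {0<..} (\<lambda>t. (1 - exp (- t)) * m t)"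
  shows "levy_density m"
  unfolding levy_density_def
proof (intro conjI allI impI nn)
  have meas: "(\<lambda>t. indicator {0<..} t *\<^sub>R ((1 - exp (- t)) * m t)) \<in> borel_measurable borel"
    using int by (auto simp: set_integrable_def dest: borel_measurable_integrable)
  show "set_integrable lborel {0<..} (\<lambda>t. min 1 t * m t)"
  proof (rule set_integrable_bound_lborel)
    show "set_integrable lborel {0<..} (\<lambda>t. 2 * ((1 - exp (- t)) * m t))"
      by (rule set_integrable_mult_right) (use int in simp)
    have "(\<lambda>t. min 1 t * inverse (1 - exp (- t)) * (indicator {0<..} t *\<^sub>R ((1 - exp (- t)) * m t)))
        \<in> borel_measurable borel"
      using meas by measurable
    also have "(\<lambda>t. min 1 t * inverse (1 - exp (- t)) * (indicator {0<..} t *\<^sub>R ((1 - exp (- t)) * m t)))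
        = (\<lambda>t. indicator {0<..} t * (min 1 t * m t))"
      by (auto simp: fun_eq_iff split: split_indicator)
    finally show "(\<lambda>t. indicator {0<..} t * (min 1 t * m t)) \<in> borel_measurable borel" .
    fix t :: real assume t: "0 < t"
    have "exp (- t) \<le> 1 / (1 + t)"
      using exp_ge_add_one_self[of t] t by (simp add: exp_minus field_simps)
    moreover have "min 1 t \<le> 2 * (1 - 1 / (1 + t))"
      using t by (cases "t \<le> 1") (auto simp: field_simps min_def)
    moreover have "2 * (1 - 1 / (1 + t)) \<le> 2 * (1 - exp (- t))"
      using calculation(1) by simp
    ultimately have "min 1 t \<le> 2 * (1 - exp (- t))" by (blast intro: order_trans)
    then have "min 1 t * m t \<le> 2 * (1 - exp (- t)) * m t"
      using nn[OF t] by (rule mult_right_mono)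
    then have "min 1 t * m t \<le> 2 * ((1 - exp (- t)) * m t)" by (simp only: mult.assoc)
    then show "\<bar>min 1 t * m t\<bar> \<le> 2 * ((1 - exp (- t)) * m t)"
      using t nn[OF t] by (simp add: abs_mult)
  qed
qed

lemma levy_density_cong:
  assumes "\<And>t. 0 < t \<Longrightarrow> m t = m' t"
  shows "levy_density m \<longleftrightarrow> levy_density m'" "levy_integral m u = levy_integral m' u"
proof -
  have "set_integrable lborel {0<..} (\<lambda>t. min 1 t * m t)
      \<longleftrightarrow> set_integrable lborel {0<..} (\<lambda>t. min 1 t * m' t)"
    by (rule set_integrable_cong) (use assms in auto)
  then show "levy_density m \<longleftrightarrow> levy_density m'"
    using assms by (auto simp: levy_density_def)
  show "levy_integral m u = levy_integral m' u"
    unfolding levy_integral_def by (rule set_lebesgue_integral_cong) (use assms in auto)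
qed

lemma levy_add:
  assumes "levy_density m" "levy_density m'"
  shows "levy_density (\<lambda>t. m t + m' t)"
    and "0 \<le> u \<Longrightarrow> levy_integral (\<lambda>t. m t + m' t) u = levy_integral m u + levy_integral m' u"
  using assms set_integral_add[OF levy_integrable levy_integrable, of m u m' u]
    set_integral_add(1)[of lborel "{0<..}" "\<lambda>t. min 1 t * m t" "\<lambda>t. min 1 t * m' t"]
  by (auto simp: levy_density_def levy_integral_def distrib_left)

lemma levy_diff:
  assumes "levy_density m" "levy_density m'" "\<And>t. 0 < t \<Longrightarrow> m' t \<le> m t"
  shows "levy_density (\<lambda>t. m t - m' t)"
    and "0 \<le> u \<Longrightarrow> levy_integral (\<lambda>t. m t - m' t) u = levy_integral m u - levy_integral m' u"
  using assms set_integral_diff[OF levy_integrable levy_integrable, of m u m' u]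
    set_integral_diff(1)[of lborel "{0<..}" "\<lambda>t. min 1 t * m t" "\<lambda>t. min 1 t * m' t"]
  by (auto simp: levy_density_def levy_integral_def right_diff_distrib)

text \<open>The substitution of c t for t: the new density is the image of m(t) dt under dilation by
  c, hence the Levy density of c X if m is that of X.\<close>

lemma levy_scale:
  assumes m: "levy_density m" and c: "0 < c"
  shows "levy_density (\<lambda>t. m (t / c) / c)"
    and "levy_integral (\<lambda>t. m (t / c) / c) u = levy_integral m (c * u)"
proof -
  have ind: "indicator {0<..} (c * t) = (indicator {0<..} t :: real)" for t
    using c by (auto simp: zero_less_mult_iff split: split_indicator)
  have eq: "indicator {0<..} (c * t) *\<^sub>R ((1 - exp (- u * (c * t))) * (m (c * t / c) / c))
      = (indicator {0<..} t *\<^sub>R ((1 - exp (- (c * u) * t)) * m t)) / c" for t u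
    using c unfolding ind by (simp add: mult_ac)
  show "levy_density (\<lambda>t. m (t / c) / c)"
  proof (rule levy_densityI)
    show "0 \<le> m (t / c) / c" if "0 < t" for t
      using levy_density_nonneg[OF m, of "t / c"] that c by simp
    have "integrable lborel (\<lambda>t. (indicator {0<..} t *\<^sub>R ((1 - exp (- (c * 1) * t)) * m t)) / c)"
      using levy_integrable[OF m, of "c * 1"] c unfolding set_integrable_def by auto
    then have "integrable lborel
        (\<lambda>t. indicator {0<..} t *\<^sub>R ((1 - exp (- 1 * t)) * (m (t / c) / c)))"
      unfolding eq[symmetric]
      using lborel_integrable_real_affine_iff[of c "\<lambda>t. indicator {0<..} t *\<^sub>R ((1 - exp (- 1 * t)) * (m (t / c) / c))" 0] c
      by simp
    then show "set_integrable lborel {0<..} (\<lambda>t. (1 - exp (- t)) * (m (t / c) / c))"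
      by (simp add: set_integrable_def)
  qed
  have "levy_integral (\<lambda>t. m (t / c) / c) u
      = \<bar>c\<bar> *\<^sub>R (\<integral>t. indicator {0<..} (0 + c * t) *\<^sub>R ((1 - exp (- u * (0 + c * t))) * (m ((0 + c * t) / c) / c)) \<partial>lborel)"
    unfolding levy_integral_def set_lebesgue_integral_def
    using c by (intro lborel_integral_real_affine) auto
  also have "\<dots> = levy_integral m (c * u)"
    unfolding levy_integral_def set_lebesgue_integral_def add_0 eq using c by simp
  finally show "levy_integral (\<lambda>t. m (t / c) / c) u = levy_integral m (c * u)" .
qed

text \<open>Needed for tightness. For u at most 1 the constant \<open>max 1 u\<close> in
  \<open>levy_integrand_bound\<close> is 1, so \<open>min 1 t * m t\<close> dominates all
  integrands.\<close>

lemma levy_integral_tendsto_0: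
  assumes m: "levy_density m"
  shows "(\<lambda>n. levy_integral m (1 / Suc n)) \<longlonglongrightarrow> 0"
proof -
  have "(\<lambda>n. levy_integral m (1 / Suc n)) \<longlonglongrightarrow> (\<integral>t. 0 \<partial>(lborel :: real measure))"
    unfolding levy_integral_def set_lebesgue_integral_def
  proof (rule integral_dominated_convergence)
    show "integrable lborel (\<lambda>t. indicator {0<..} t *\<^sub>R (min 1 t * m t))"
      using m by (simp add: levy_density_def set_integrable_def)
    show "(\<lambda>t. indicator {0<..} t *\<^sub>R ((1 - exp (- (1 / Suc n) * t)) * m t)) \<in> borel_measurable lborel" for n
      using levy_measurable_mult[OF m, of "\<lambda>t. 1 - exp (- (1 / Suc n) * t)"] by simp
    show "AE t in lborel. (\<lambda>n. indicator {0<..} t *\<^sub>R ((1 - exp (- (1 / Suc n) * t)) * m t)) \<longlonglongrightarrow> 0"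
    proof (rule AE_I2)
      fix t :: real
      have "(\<lambda>n. indicator {0<..} t *\<^sub>R ((1 - exp (- (1 / Suc n) * t)) * m t))
          \<longlonglongrightarrow> indicator {0<..} t *\<^sub>R ((1 - exp (- 0 * t)) * m t)"
        by (intro tendsto_intros LIMSEQ_inverse_real_of_nat[unfolded inverse_eq_divide])
      then show "(\<lambda>n. indicator {0<..} t *\<^sub>R ((1 - exp (- (1 / Suc n) * t)) * m t)) \<longlonglongrightarrow> 0" by simp
    qed
    show "AE t in lborel. norm (indicator {0<..} t *\<^sub>R ((1 - exp (- (1 / Suc n) * t)) * m t))
        \<le> indicator {0<..} t *\<^sub>R (min 1 t * m t)" for n
    proof (rule AE_I2)
      fix t :: real
      show "norm (indicator {0<..} t *\<^sub>R ((1 - exp (- (1 / Suc n) * t)) * m t))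
        \<le> indicator {0<..} t *\<^sub>R (min 1 t * m t)"
      proof (cases "0 < t")
        case True
        have "(1 - exp (- (1 / Suc n) * t)) * m t \<le> min 1 t * m t"
          using levy_integrand_bound[of "1 / Suc n" t] True levy_density_nonneg[OF m True]
          by (intro mult_right_mono) auto
        with True levy_density_nonneg[OF m True] show ?thesis by (simp add: abs_mult)
      qed simp
    qed
  qed simp
  then show ?thesis by simp
qed

text \<open>The second difference \<open>2\<psi>(u + 1) - \<psi>(u) - \<psi>(u + 2)\<close> of \<open>\<psi>(u) = a u + \<integral>(1 - e\<^sup>-\<^sup>u\<^sup>t) m(t) dt\<close> is the
  Laplace transform of the finite measure \<open>(1 - e\<^sup>-\<^sup>t)\<^sup>2 m(t) dt\<close>.\<close>

lemma levy_density_unique: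
  assumes m: "levy_density m" and m': "levy_density m'"
    and eq: "\<And>u. 0 \<le> u \<Longrightarrow> a * u + levy_integral m u = a' * u + levy_integral m' u"
  shows "AE t in lborel. 0 < t \<longrightarrow> m t = m' t"
proof -
  \<comment> \<open>A first difference of the exponent would leave the drift as a constant. The
    second difference removes it, so the drifts \<open>a\<close> and \<open>a'\<close> need not be
    compared. The weight is nonzero for t > 0, which allows \<open>m\<close> to be read off at the
    end.\<close>
  define w where "w m t = indicator {0<..} t * ((1 - exp (- t))\<^sup>2 * m t)" for m :: "real \<Rightarrow> real" and t
  have w_nn: "0 \<le> w m t" if "levy_density m" for m t
    using levy_density_nonneg[OF that] by (auto simp: w_def split: split_indicator)
  have w_meas: "w m \<in> borel_measurable borel" if "levy_density m" for m
    unfolding w_def by (rule levy_measurable_mult[OF that]) measurable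
  have second: "integrable lborel (\<lambda>t. exp (- u * t) * w m t)"
    "(\<integral>t. exp (- u * t) * w m t \<partial>lborel)
      = 2 * levy_integral m (u + 1) - levy_integral m u - levy_integral m (u + 2)"
    if m: "levy_density m" and u: "0 \<le> u" for m u
  proof -
    let ?f = "\<lambda>u t. indicator {0<..} t *\<^sub>R ((1 - exp (- u * t)) * m t)"
    have i: "integrable lborel (?f u)" if "0 \<le> u" for u
      using levy_integrable[OF m that] by (simp add: set_integrable_def)
    have e: "exp (- u * t) * w m t = 2 * ?f (u + 1) t - ?f u t - ?f (u + 2) t" for t
    proof -
      have "exp (- (u + 1) * t) = exp (- u * t) * exp (- t)"
        by (simp add: algebra_simps flip: exp_add)
      moreover have "exp (- (u + 2) * t) = exp (- u * t) * exp (- t) * exp (- t)"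
        by (simp add: algebra_simps flip: exp_add)
      ultimately show ?thesis
        by (simp add: w_def power2_eq_square algebra_simps split: split_indicator)
    qed
    show "integrable lborel (\<lambda>t. exp (- u * t) * w m t)"
      unfolding e
      by (intro Bochner_Integration.integrable_diff integrable_mult_right i) (use u in simp_all)
    show "(\<integral>t. exp (- u * t) * w m t \<partial>lborel)
      = 2 * levy_integral m (u + 1) - levy_integral m u - levy_integral m (u + 2)"
      unfolding e levy_integral_def set_lebesgue_integral_def using i[of u] i[of "u + 1"] i[of "u + 2"] u
      by simp
  qed
  have fin: "finite_measure (density lborel (\<lambda>t. ennreal (w m t)))" if m: "levy_density m" for m
  proof -
    have "(\<integral>\<^sup>+t. ennreal (w m t) \<partial>lborel) < \<infinity>"
      using second(1)[OF m, of 0] w_nn[OF m] w_meas[OF m]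
      by (subst nn_integral_eq_integral) auto
    then show ?thesis
      using w_meas[OF m] by (intro finite_measureI) (simp add: emeasure_density)
  qed
  have lap: "(\<integral>t. exp (- u * t) \<partial>density lborel (\<lambda>t. ennreal (w m t)))
      = (\<integral>t. exp (- u * t) * w m t \<partial>lborel)" if m: "levy_density m" for m u
    using w_meas[OF m] w_nn[OF m] by (subst integral_density) (auto simp: mult.commute)
  have supp: "AE t in density lborel (\<lambda>t. ennreal (w m t)). 0 \<le> t" if "levy_density m" for m
  proof (subst AE_density)
    show "(\<lambda>t. ennreal (w m t)) \<in> borel_measurable lborel" using w_meas[OF that] by simp
    show "AE t in lborel. 0 < ennreal (w m t) \<longrightarrow> 0 \<le> t"
      by (rule AE_I2) (simp add: w_def split: split_indicator)
  qed
  have "density lborel (\<lambda>t. ennreal (w m t)) = density lborel (\<lambda>t. ennreal (w m' t))"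
  proof (rule finite_measure_laplace_unique)
    fix n :: nat
    have "2 * levy_integral m (n + 1) - levy_integral m n - levy_integral m (n + 2)
        = 2 * levy_integral m' (n + 1) - levy_integral m' n - levy_integral m' (n + 2)"
      using eq[of n] eq[of "n + 1"] eq[of "n + 2"] by (simp add: algebra_simps)
    then show "(\<integral>t. exp (- real n * t) \<partial>density lborel (\<lambda>t. ennreal (w m t)))
        = (\<integral>t. exp (- real n * t) \<partial>density lborel (\<lambda>t. ennreal (w m' t)))"
      using second(2)[OF m, of n] second(2)[OF m', of n] lap[OF m, of n] lap[OF m', of n]
      by (simp add: add.commute)
  qed (use fin supp m m' in auto)
  then have "AE t in lborel. ennreal (w m t) = ennreal (w m' t)"
    using w_meas[OF m] w_meas[OF m'] by (subst (asm) sigma_finite_measure.density_unique_iff[OF sigma_finite_lborel]) auto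
  then show ?thesis
  proof eventually_elim
    case (elim t)
    then have "w m t = w m' t" using w_nn[OF m] w_nn[OF m'] by simp
    then show ?case by (auto simp: w_def)
  qed
qed

subsection \<open>Laws with a prescribed Levy density\<close>

text \<open>Beyond 1/u the exponential is at most 1/2, because \<open>exp y \<ge> 1 + y > 2\<close>
  for y > 1; so the Laplace transform is at most 1/2 plus half the mass below. The left endpoint -1
  lets the half-open interval contain 0.\<close>

lemma nonneg_law_tail_bound:
  assumes \<mu>: "nonneg_law \<mu>" and u: "0 < u"
  shows "1 - 2 * (1 - (\<integral>x. exp (- u * x) \<partial>\<mu>)) \<le> measure \<mu> {-1<..1 / u}"
proof -
  interpret real_distribution \<mu> by (rule nonneg_law_real_distribution[OF \<mu>])
  have ind: "integrable \<mu> (indicator {-1<..1 / u} :: real \<Rightarrow> real)"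
    by (rule integrable_const_bound[of _ 1]) (auto split: split_indicator)
  have "(\<integral>x. exp (- u * x) \<partial>\<mu>) \<le> (\<integral>x. 1 / 2 + 1 / 2 * indicator {-1<..1 / u} x \<partial>\<mu>)"
  proof (rule integral_mono_AE)
    show "integrable \<mu> (\<lambda>x. exp (- u * x))" using nonneg_law_integrable_exp[OF \<mu>] u by simp
    show "integrable \<mu> (\<lambda>x. 1 / 2 + 1 / 2 * indicator {-1<..1 / u} x :: real)"
      using ind by simp
    show "AE x in \<mu>. exp (- u * x) \<le> 1 / 2 + 1 / 2 * indicator {-1<..1 / u} x"
      using nonneg_law_AE[OF \<mu>]
    proof eventually_elim
      case (elim x)
      show ?case
      proof (cases "x \<le> 1 / u")
        case True
        with elim u show ?thesis by simp
      next
        case False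
        then have "1 < u * x" using u by (simp add: field_simps)
        then have "2 \<le> exp (u * x)" using exp_ge_add_one_self[of "u * x"] by linarith
        then show ?thesis using False by (simp add: exp_minus field_simps)
      qed
    qed
  qed
  also have "\<dots> = 1 / 2 + 1 / 2 * measure \<mu> {-1<..1 / u}"
    using ind prob_space by simp
  finally show ?thesis by (simp add: field_simps)
qed

text \<open>The continuity theorem for Laplace transforms. The hypothesis \<open>small\<close>
  yields tightness through \<open>nonneg_law_tail_bound\<close>; the limit along a weakly convergent
  subsequence then has the prescribed exponent.\<close>

lemma nonneg_law_limit:
  fixes \<nu> :: "nat \<Rightarrow> real measure"
  assumes \<nu>: "\<And>n. nonneg_law (\<nu> n)"
    and lim: "\<And>u. 0 \<le> u \<Longrightarrow> (\<lambda>n. \<integral>x. exp (- u * x) \<partial>\<nu> n) \<longlonglongrightarrow> exp (- \<psi> u)"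
    and small: "\<And>e. 0 < e \<Longrightarrow> \<exists>u>0. \<forall>n. 1 - e < (\<integral>x. exp (- u * x) \<partial>\<nu> n)"
  shows "\<exists>\<mu>. nonneg_law \<mu> \<and> (\<forall>u\<ge>0. laplace_exponent \<mu> u = \<psi> u)"
proof -
  have rd: "real_distribution (\<nu> n)" for n by (rule nonneg_law_real_distribution[OF \<nu>])
  have "tight \<nu>"
    unfolding tight_def
  proof (intro conjI allI impI rd)
    fix e :: real assume "0 < e"
    then obtain u where u: "0 < u" "\<And>n. 1 - e / 2 < (\<integral>x. exp (- u * x) \<partial>\<nu> n)"
      using small[of "e / 2"] by auto
    have "1 - e < measure (\<nu> n) {-1<..1 / u}" for n
    proof (rule less_le_trans[OF _ nonneg_law_tail_bound[OF \<nu>[of n] u(1)]])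
      show "1 - e < 1 - 2 * (1 - (\<integral>x. exp (- u * x) \<partial>\<nu> n))" using u(2)[of n] by simp
    qed
    moreover have "-1 < 1 / u" using u(1) by (meson divide_pos_pos less_trans neg_less_0_iff_less zero_less_one)
    ultimately show "\<exists>a b. a < b \<and> (\<forall>n. 1 - e < measure (\<nu> n) {a<..b})" by blast
  qed
  from tight_imp_convergent_subsubsequence[OF this strict_mono_id]
  obtain r \<mu> where r: "strict_mono (r :: nat \<Rightarrow> nat)" and \<mu>: "real_distribution \<mu>"
    and conv: "weak_conv_m (\<nu> \<circ> r) \<mu>"
    by (auto simp: id_def comp_def)
  interpret real_distribution \<mu> by fact
  have cts: "(\<lambda>n. \<integral>x. f x \<partial>(\<nu> \<circ> r) n) \<longlonglongrightarrow> (\<integral>x. f x \<partial>\<mu>)"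
    if "\<And>x. isCont f x" "\<And>x. norm (f x) \<le> 1" for f :: "real \<Rightarrow> real"
    using that rd by (intro weak_conv_imp_integral_bdd_continuous_conv[OF _ \<mu> conv]) auto
  have AE_int: "(\<integral>x. f x \<partial>\<nu> n) = (\<integral>x. g x \<partial>\<nu> n)"
    if [measurable]: "f \<in> borel_measurable borel" "g \<in> borel_measurable borel"
      and "\<And>x. 0 \<le> x \<Longrightarrow> f x = g x" for n and f g :: "real \<Rightarrow> real"
  proof (rule integral_cong_AE)
    show "AE x in \<nu> n. f x = g x"
      using nonneg_law_AE[OF \<nu>] by eventually_elim (use that in auto)
  qed (use real_distribution.events_eq_borel[OF rd] in
        \<open>auto simp: measurable_cong_sets[of "\<nu> n" borel]\<close>)
  \<comment> \<open>A bounded continuous function that vanishes exactly on the half-line; its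
    integral detects mass on the negative side of the limit.\<close>
  let ?f = "\<lambda>x::real. min 1 (max 0 (- x))"
  have "(\<lambda>n. \<integral>x. ?f x \<partial>(\<nu> \<circ> r) n) \<longlonglongrightarrow> (\<integral>x. ?f x \<partial>\<mu>)"
    by (rule cts) (auto intro!: continuous_intros)
  moreover have "(\<integral>x. ?f x \<partial>(\<nu> \<circ> r) n) = (\<integral>x. 0 \<partial>(\<nu> \<circ> r) n)" for n
    unfolding comp_def by (rule AE_int) auto
  ultimately have "(\<integral>x. ?f x \<partial>\<mu>) = 0"
    by (simp add: LIMSEQ_const_iff)
  moreover have "integrable \<mu> ?f"
    by (rule integrable_const_bound[of _ 1]) (auto intro!: AE_I2)
  ultimately have "AE x in \<mu>. ?f x = 0"
    by (subst (asm) integral_nonneg_eq_0_iff_AE) auto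
  then have "AE x in \<mu>. 0 \<le> x"
    by eventually_elim (auto simp: min_def max_def split: if_splits)
  then have nn: "nonneg_law \<mu>" using \<mu> by (simp add: nonneg_law_def)
  have "laplace_exponent \<mu> u = \<psi> u" if u: "0 \<le> u" for u
  proof (rule laplace_exponent_eqI[OF nn])
    \<comment> \<open>The exponential itself may be unbounded on the negative axis. Truncating at 0
      gives a bounded continuous test function that agrees with it almost surely under all the laws
      involved.\<close>
    let ?g = "\<lambda>x::real. exp (- u * max 0 x)"
    have "(\<lambda>n. \<integral>x. ?g x \<partial>(\<nu> \<circ> r) n) \<longlonglongrightarrow> (\<integral>x. ?g x \<partial>\<mu>)"
      using u by (intro cts) (auto intro!: continuous_intros)
    moreover have "(\<integral>x. ?g x \<partial>(\<nu> \<circ> r) n) = (\<integral>x. exp (- u * x) \<partial>\<nu> (r n))" for n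
      unfolding comp_def by (rule AE_int) (auto simp: max_def)
    moreover have "(\<integral>x. ?g x \<partial>\<mu>) = (\<integral>x. exp (- u * x) \<partial>\<mu>)"
    proof (rule integral_cong_AE)
      show "AE x in \<mu>. ?g x = exp (- u * x)"
        using nonneg_law_AE[OF nn] by eventually_elim auto
    qed auto
    ultimately have "(\<lambda>n. \<integral>x. exp (- u * x) \<partial>\<nu> (r n)) \<longlonglongrightarrow> (\<integral>x. exp (- u * x) \<partial>\<mu>)" by simp
    moreover have "(\<lambda>n. \<integral>x. exp (- u * x) \<partial>\<nu> (r n)) \<longlonglongrightarrow> exp (- \<psi> u)"
      using LIMSEQ_subseq_LIMSEQ[OF lim[OF u] r] by (simp add: comp_def)
    ultimately show "(\<integral>x. exp (- u * x) \<partial>\<mu>) = exp (- \<psi> u)"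
      by (rule LIMSEQ_unique)
  qed
  with nn show ?thesis by blast
qed

text \<open>The missing mass \<open>1 - \<integral>q\<close> is placed at \<open>0\<close>: it is spread over \<open>(-1, 0]\<close> and pushed forward
  under \<open>max 0\<close>.\<close>

lemma nonneg_law_from_subdensity:
  fixes q :: "real \<Rightarrow> real"
  assumes q: "\<And>t. 0 \<le> q t" "\<And>t. t \<le> 0 \<Longrightarrow> q t = 0" "integrable lborel q" "(\<integral>t. q t \<partial>lborel) \<le> 1"
  shows "\<exists>\<rho>. nonneg_law \<rho> \<and>
    (\<forall>u\<ge>0. (\<integral>x. exp (- u * x) \<partial>\<rho>) = 1 - (\<integral>t. (1 - exp (- u * t)) * q t \<partial>lborel))"
proof -
  have [measurable]: "q \<in> borel_measurable borel" using q(3) by simp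
  define p where "p = (\<integral>t. q t \<partial>lborel)"
  define f where "f t = q t + (1 - p) * indicator {-1<..0} t" for t :: real
  have f_nn: "0 \<le> f t" for t using q(1,4) by (simp add: f_def p_def)
  have [measurable]: "f \<in> borel_measurable borel" unfolding f_def by measurable
  have ind: "integrable lborel (indicator {-1<..0} :: real \<Rightarrow> real)"
    by (rule integrable_real_indicator) auto
  have f_int: "integrable lborel f"
    unfolding f_def using q(3) ind by auto
  have f_one: "(\<integral>t. f t \<partial>lborel) = 1"
    unfolding f_def using q(3) ind by (simp add: p_def)
  let ?D = "density lborel (\<lambda>t. ennreal (f t))"
  have "emeasure ?D (space ?D) = ennreal (\<integral>t. f t \<partial>lborel)"
    using f_int f_nn by (simp add: emeasure_density nn_integral_eq_integral)
  then interpret D: prob_space ?D using f_one by (intro prob_spaceI) simp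
  let ?\<rho> = "distr ?D borel (\<lambda>t. max 0 t)"
  have nn: "nonneg_law ?\<rho>"
    unfolding nonneg_law_def by (intro conjI D.real_distribution_distr) (auto simp: AE_distr_iff)
  have "(\<integral>x. exp (- u * x) \<partial>?\<rho>) = 1 - (\<integral>t. (1 - exp (- u * t)) * q t \<partial>lborel)" if u: "0 \<le> u" for u
  proof -
    have qe: "integrable lborel (\<lambda>t. (1 - exp (- u * t)) * q t)"
    proof (rule Bochner_Integration.integrable_bound[OF q(3)])
      show "AE t in lborel. norm ((1 - exp (- u * t)) * q t) \<le> norm (q t)"
      proof (rule AE_I2)
        fix t :: real
        show "norm ((1 - exp (- u * t)) * q t) \<le> norm (q t)"
        proof (cases "t \<le> 0")
          case False
          then have "\<bar>1 - exp (- u * t)\<bar> \<le> 1" using u by simp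
          then show ?thesis by (simp add: abs_mult mult_left_le_one_le)
        qed (simp add: q(2))
      qed
    qed measurable
    have "(\<integral>x. exp (- u * x) \<partial>?\<rho>) = (\<integral>t. f t * exp (- u * max 0 t) \<partial>lborel)"
      using f_nn by (simp add: integral_distr integral_density)
    also have "\<dots> = (\<integral>t. f t - (1 - exp (- u * t)) * q t \<partial>lborel)"
    proof (rule Bochner_Integration.integral_cong[OF refl])
      fix t :: real
      show "f t * exp (- u * max 0 t) = f t - (1 - exp (- u * t)) * q t"
        by (cases "t \<le> 0") (auto simp: f_def q(2) algebra_simps)
    qed
    also have "\<dots> = 1 - (\<integral>t. (1 - exp (- u * t)) * q t \<partial>lborel)"
      using f_int qe f_one by simp
    finally show ?thesis .
  qed
  with nn show ?thesis by blast
qed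

text \<open>After taking logarithms, the quadratic error bound for \<open>ln\<close> multiplied by
  \<open>Suc n\<close> leaves \<open>2 * (\<bar>x n\<bar> * \<bar>y n\<bar>)\<close>, a convergent
  sequence times a null sequence.\<close>

lemma one_minus_div_power_tendsto_exp:
  fixes x :: "nat \<Rightarrow> real"
  assumes x: "x \<longlonglongrightarrow> l"
  shows "(\<lambda>n. (1 - x n / Suc n) ^ Suc n) \<longlonglongrightarrow> exp (- l)"
proof -
  define y where "y n = x n / Suc n" for n
  have y: "y \<longlonglongrightarrow> 0"
    unfolding y_def using tendsto_mult[OF x LIMSEQ_inverse_real_of_nat] by (simp add: field_simps)
  have "(\<lambda>n. Suc n * ln (1 - y n) + x n) \<longlonglongrightarrow> 0"
  proof (rule Lim_null_comparison)
    have "\<forall>\<^sub>F n in sequentially. \<bar>y n\<bar> < 1 / 2"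
      using tendstoD[OF y, of "1 / 2"] by simp
    then show "\<forall>\<^sub>F n in sequentially. norm (Suc n * ln (1 - y n) + x n) \<le> 2 * (\<bar>x n\<bar> * \<bar>y n\<bar>)"
    proof eventually_elim
      case (elim n)
      have "\<bar>ln (1 + - y n) - - y n\<bar> \<le> 2 * (- y n)\<^sup>2"
        using elim by (intro abs_ln_one_plus_x_minus_x_bound) simp
      then have "Suc n * \<bar>ln (1 - y n) + y n\<bar> \<le> Suc n * (2 * (y n)\<^sup>2)"
        by (intro mult_left_mono) auto
      moreover have "Suc n * \<bar>ln (1 - y n) + y n\<bar> = \<bar>Suc n * ln (1 - y n) + x n\<bar>"
      proof -
        have "Suc n * (ln (1 - y n) + y n) = Suc n * ln (1 - y n) + x n"
          by (simp add: y_def distrib_left)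
        then show ?thesis by (metis abs_mult abs_of_nat)
      qed
      moreover have "Suc n * (2 * (y n)\<^sup>2) = 2 * (\<bar>x n\<bar> * \<bar>y n\<bar>)"
      proof -
        have xy: "x n = Suc n * y n" by (simp add: y_def del: of_nat_Suc)
        show ?thesis unfolding xy by (simp add: abs_mult power2_eq_square del: of_nat_Suc)
      qed
      ultimately show ?case by (simp only: real_norm_def)
    qed
    have "(\<lambda>n. 2 * (\<bar>x n\<bar> * \<bar>y n\<bar>)) \<longlonglongrightarrow> 2 * (\<bar>l\<bar> * \<bar>0\<bar>)"
      by (intro tendsto_intros x y)
    then show "(\<lambda>n. 2 * (\<bar>x n\<bar> * \<bar>y n\<bar>)) \<longlonglongrightarrow> 0" by simp
  qed
  from tendsto_exp[OF tendsto_diff[OF this x]]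
  have "(\<lambda>n. exp (Suc n * ln (1 - y n))) \<longlonglongrightarrow> exp (- l)" by simp
  moreover have "\<forall>\<^sub>F n in sequentially. exp (Suc n * ln (1 - y n)) = (1 - x n / Suc n) ^ Suc n"
    using order_tendstoD(2)[OF y zero_less_one]
  proof eventually_elim
    case (elim n)
    then show ?case by (simp only: exp_of_nat_mult y_def) simp
  qed
  ultimately show ?thesis by (rule Lim_transform_eventually)
qed

text \<open>The subdensity \<open>q\<^sub>n = min(1,t) m(t) / (C + 1 + (n+1) min(1,t))\<close>, with \<open>C = \<integral> min(1,t) m(t) dt\<close>, has mass
  at most \<open>1\<close>, and \<open>(n+1) q\<^sub>n\<close> increases to \<open>m\<close>. The \<open>(n+1)\<close>-fold convolutions of the laws built from \<open>q\<^sub>n\<close>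
  converge.\<close>

lemma nonneg_law_of_levy_density:
  assumes m: "levy_density m" and a: "0 \<le> a"
  shows "\<exists>\<mu>. nonneg_law \<mu> \<and> (\<forall>u\<ge>0. laplace_exponent \<mu> u = a * u + levy_integral m u)"
proof -
  let ?i = "\<lambda>t. indicator {0<..} t * (min 1 t * m t)"
  define C where "C = (\<integral>t. ?i t \<partial>lborel)"
  have i_int: "integrable lborel ?i"
    using m by (simp add: levy_density_def set_integrable_def)
  have i_nn: "0 \<le> ?i t" for t
    using levy_density_nonneg[OF m] by (auto split: split_indicator)
  have C: "0 \<le> C" unfolding C_def using i_nn by (intro integral_nonneg_AE AE_I2)
  \<comment> \<open>The summand 1 keeps the denominator positive when C = 0, and
    \<open>max 0 t\<close> keeps it positive for negative t, where the numerator vanishes.\<close>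
  define s where "s n t = (C + 1) + real (Suc n) * min 1 (max 0 t)" for n and t :: real
  have s_pos: "1 \<le> s n t" "C + 1 \<le> s n t" for n t
    using C by (auto simp: s_def)
  define q where "q n t = ?i t / s n t" for n t
  have q_nn: "0 \<le> q n t" for n t
    unfolding q_def using i_nn s_pos(1)[of n t] by (intro divide_nonneg_nonneg) auto
  have q_meas[measurable]: "q n \<in> borel_measurable borel" for n
  proof -
    have [measurable]: "?i \<in> borel_measurable borel" using i_int by simp
    show ?thesis unfolding q_def s_def by measurable
  qed
  have q_le: "q n t \<le> ?i t / (C + 1)" for n t
    unfolding q_def using i_nn s_pos[of n t] C by (intro divide_left_mono mult_pos_pos) auto
  have q_int: "integrable lborel (q n)" for n
  proof (rule Bochner_Integration.integrable_bound)
    show "integrable lborel (\<lambda>t. ?i t / (C + 1))" using i_int by (rule integrable_divide)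
    show "AE t in lborel. norm (q n t) \<le> norm (?i t / (C + 1))"
    proof (rule AE_I2)
      fix t
      have "0 \<le> ?i t / (C + 1)" using i_nn C by (intro divide_nonneg_nonneg) auto
      then show "norm (q n t) \<le> norm (?i t / (C + 1))"
        using q_le[of n t] q_nn[of n t] by (simp only: real_norm_def abs_of_nonneg)
    qed
  qed measurable
  have q_one: "(\<integral>t. q n t \<partial>lborel) \<le> 1" for n
  proof -
    have "(\<integral>t. q n t \<partial>lborel) \<le> (\<integral>t. ?i t / (C + 1) \<partial>lborel)"
      using i_int q_int q_le by (intro integral_mono integrable_divide) auto
    also have "\<dots> = C / (C + 1)" by (simp only: integral_divide_zero C_def)
    also have "\<dots> \<le> 1" using C by simp
    finally show ?thesis .
  qed
  have scaled_le: "Suc n * q n t \<le> indicator {0<..} t * m t" for n t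
  proof (cases "0 < t")
    case True
    have "real (Suc n) * min 1 t \<le> s n t" using C True by (simp add: s_def)
    then have "Suc n * min 1 t / s n t \<le> 1" using s_pos(1)[of n t] by (simp add: field_simps)
    then have "Suc n * min 1 t / s n t * m t \<le> 1 * m t"
      by (rule mult_right_mono) (rule levy_density_nonneg[OF m True])
    then show ?thesis using True by (simp add: q_def mult.assoc)
  qed (simp add: q_def)
  define x where "x n u = (\<integral>t. (1 - exp (- u * t)) * (Suc n * q n t) \<partial>lborel)" for n u
  have xq: "(\<integral>t. (1 - exp (- u * t)) * q n t \<partial>lborel) = x n u / Suc n" for n u
    unfolding x_def by (simp add: mult.left_commute[of _ "real (Suc n)"] del: of_nat_Suc)
  have lint: "integrable lborel (\<lambda>t. (1 - exp (- u * t)) * (indicator {0<..} t * m t))"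
    if "0 \<le> u" for u
    using levy_integrable[OF m that] by (simp add: set_integrable_def mult.left_commute)
  have bound: "norm ((1 - exp (- u * t)) * (Suc n * q n t))
      \<le> (1 - exp (- u * t)) * (indicator {0<..} t * m t)" if u: "0 \<le> u" for n t u
  proof (cases "0 < t")
    case True
    have "(1 - exp (- u * t)) * (Suc n * q n t) \<le> (1 - exp (- u * t)) * (indicator {0<..} t * m t)"
      using scaled_le levy_integrand_bound(1)[OF u True] by (rule mult_left_mono)
    moreover have "0 \<le> (1 - exp (- u * t)) * (Suc n * q n t)"
      using levy_integrand_bound(1)[OF u True] q_nn by (intro mult_nonneg_nonneg) auto
    ultimately show ?thesis by simp
  qed (simp add: q_def)
  have x_le: "x n u \<le> levy_integral m u" if u: "0 \<le> u" for n u
  proof -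
    have "x n u \<le> (\<integral>t. (1 - exp (- u * t)) * (indicator {0<..} t * m t) \<partial>lborel)"
      unfolding x_def
      by (rule integral_mono_AE'[OF lint[OF u]])
        (use bound[OF u] in \<open>auto intro!: AE_I2 dest: abs_le_D1 intro: order_trans[OF abs_ge_zero]\<close>)
    then show ?thesis
      by (simp add: levy_integral_def set_lebesgue_integral_def mult.left_commute)
  qed
  have x_lim: "(\<lambda>n. x n u) \<longlonglongrightarrow> levy_integral m u" if u: "0 \<le> u" for u
  proof -
    have "(\<lambda>n. x n u) \<longlonglongrightarrow> (\<integral>t. (1 - exp (- u * t)) * (indicator {0<..} t * m t) \<partial>lborel)"
      unfolding x_def
    proof (rule integral_dominated_convergence[OF _ _ lint[OF u]])
      show "(\<lambda>t. (1 - exp (- u * t)) * (indicator {0<..} t * m t)) \<in> borel_measurable lborel"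
        using lint[OF u] by (rule borel_measurable_integrable)
      show "AE t in lborel. norm ((1 - exp (- u * t)) * (Suc n * q n t))
          \<le> (1 - exp (- u * t)) * (indicator {0<..} t * m t)" for n
        using bound[OF u] by (intro AE_I2)
      show "AE t in lborel. (\<lambda>n. (1 - exp (- u * t)) * (Suc n * q n t))
          \<longlonglongrightarrow> (1 - exp (- u * t)) * (indicator {0<..} t * m t)"
      proof (rule AE_I2)
        fix t :: real
        have "(\<lambda>n. Suc n * q n t) \<longlonglongrightarrow> indicator {0<..} t * m t"
        proof (cases "0 < t")
          case True
          let ?b = "min 1 t"
          have b: "0 < ?b" using True by simp
          have "(\<lambda>n. ?b * m t / ((C + 1) * inverse (real (Suc n)) + ?b)) \<longlonglongrightarrow> ?b * m t / ((C + 1) * 0 + ?b)"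
            using b by (intro tendsto_intros LIMSEQ_inverse_real_of_nat) auto
          moreover have "Suc n * q n t = ?b * m t / ((C + 1) * inverse (real (Suc n)) + ?b)" for n
          proof -
            have "s n t = real (Suc n) * ((C + 1) * inverse (real (Suc n)) + ?b)"
              using True by (simp add: s_def distrib_left del: of_nat_Suc)
            then show ?thesis using True by (simp add: q_def del: of_nat_Suc)
          qed
          ultimately show ?thesis using b True by simp
        qed (simp add: q_def)
        then show "(\<lambda>n. (1 - exp (- u * t)) * (Suc n * q n t))
          \<longlonglongrightarrow> (1 - exp (- u * t)) * (indicator {0<..} t * m t)"
          by (rule tendsto_mult_left)
      qed
    qed measurable
    then show ?thesis
      by (simp add: levy_integral_def set_lebesgue_integral_def mult.left_commute)
  qed
  \<comment> \<open>Nonnegativity of the base, clear because it is a Laplace transform, is recorded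
    for the use of Bernoulli's inequality below.\<close>
  have "\<exists>\<nu>. nonneg_law \<nu> \<and> (\<forall>u\<ge>0. (\<integral>y. exp (- u * y) \<partial>\<nu>) = (1 - x n u / Suc n) ^ Suc n
      \<and> 0 \<le> 1 - x n u / Suc n)" for n
  proof -
    obtain \<rho> where \<rho>: "nonneg_law \<rho>" "\<And>u. 0 \<le> u \<Longrightarrow> (\<integral>y. exp (- u * y) \<partial>\<rho>) = 1 - x n u / Suc n"
      using nonneg_law_from_subdensity[of "q n", OF q_nn _ q_int q_one] unfolding xq
      by (auto simp: q_def)
    obtain \<nu> where \<nu>: "nonneg_law \<nu>"
      "\<And>u. 0 \<le> u \<Longrightarrow> laplace_exponent \<nu> u = real (Suc n) * laplace_exponent \<rho> u"
      using nonneg_law_convolution_power[OF \<rho>(1), of "Suc n"] by blast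
    have "(\<integral>y. exp (- u * y) \<partial>\<nu>) = (1 - x n u / Suc n) ^ Suc n \<and> 0 \<le> 1 - x n u / Suc n"
      if u: "0 \<le> u" for u
    proof -
      have \<rho>u: "1 - x n u / Suc n = exp (- laplace_exponent \<rho> u)"
        using \<rho>(2)[OF u] laplace_transform_eq_exponent[OF \<rho>(1) u] by simp
      have "(\<integral>y. exp (- u * y) \<partial>\<nu>) = exp (real (Suc n) * - laplace_exponent \<rho> u)"
        using laplace_transform_eq_exponent[OF \<nu>(1) u] \<nu>(2)[OF u] by simp
      then show ?thesis unfolding \<rho>u exp_of_nat_mult by simp
    qed
    with \<nu>(1) show ?thesis by blast
  qed
  then obtain \<nu> where \<nu>: "\<And>n. nonneg_law (\<nu> n)"
    "\<And>n u. 0 \<le> u \<Longrightarrow> (\<integral>y. exp (- u * y) \<partial>\<nu> n) = (1 - x n u / Suc n) ^ Suc n"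
    "\<And>n u. 0 \<le> u \<Longrightarrow> 0 \<le> 1 - x n u / Suc n" by metis
  have "\<exists>\<mu>. nonneg_law \<mu> \<and> (\<forall>u\<ge>0. laplace_exponent \<mu> u = levy_integral m u)"
  proof (rule nonneg_law_limit[OF \<nu>(1)])
    show "(\<lambda>n. \<integral>y. exp (- u * y) \<partial>\<nu> n) \<longlonglongrightarrow> exp (- levy_integral m u)" if "0 \<le> u" for u
      unfolding \<nu>(2)[OF that] by (rule one_minus_div_power_tendsto_exp[OF x_lim[OF that]])
    fix e :: real assume "0 < e"
    from order_tendstoD(2)[OF levy_integral_tendsto_0[OF m] this]
    obtain j :: nat where j: "levy_integral m (1 / Suc j) < e"
      unfolding eventually_sequentially by blast
    define u where "u = 1 / real (Suc j)"
    have u: "0 < u" by (simp add: u_def)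
    have "1 - e < (\<integral>y. exp (- u * y) \<partial>\<nu> n)" for n
    proof -
      \<comment> \<open>Bernoulli's inequality bounds the n-th Laplace transform below by
        \<open>1 - x n u\<close>, and \<open>x n u\<close> is at most the Levy integral at u. That
        bound is independent of n, so one u serves the whole sequence.\<close>
      have "1 - e < 1 + Suc n * - (x n u / Suc n)"
        using x_le[of u n] u j by (simp add: u_def del: of_nat_Suc)
      also have "\<dots> \<le> (1 + - (x n u / Suc n)) ^ Suc n"
        using \<nu>(3)[of u n] u by (intro Bernoulli_inequality) simp
      finally show ?thesis using \<nu>(2)[of u n] u by simp
    qed
    with u show "\<exists>u>0. \<forall>n. 1 - e < (\<integral>y. exp (- u * y) \<partial>\<nu> n)" by blast
  qed
  then obtain \<mu> where \<mu>: "nonneg_law \<mu>" "\<And>u. 0 \<le> u \<Longrightarrow> laplace_exponent \<mu> u = levy_integral m u"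
    by blast
  with nonneg_law_convolution[OF nonneg_law_return(1)[OF a] \<mu>(1)] nonneg_law_return(2)[OF a]
  show ?thesis by (intro exI[of _ "return borel a \<star> \<mu>"]) auto
qed

subsection \<open>Factor distributions\<close>

text \<open>Controls the remainder of the telescoping series in the converse. The constant 1
  dominates, since the exponentials are at most 1 almost surely.\<close>

lemma laplace_exponent_tendsto_0:
  assumes \<mu>: "nonneg_law \<mu>" and u: "\<And>n. 0 \<le> u n" "u \<longlonglongrightarrow> 0"
  shows "(\<lambda>n. laplace_exponent \<mu> (u n)) \<longlonglongrightarrow> 0"
proof -
  interpret real_distribution \<mu> by (rule nonneg_law_real_distribution[OF \<mu>])
  have "(\<lambda>n. \<integral>x. exp (- u n * x) \<partial>\<mu>) \<longlonglongrightarrow> (\<integral>x. 1 \<partial>\<mu>)"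
  proof (rule integral_dominated_convergence[where w = "\<lambda>_. 1"])
    show "AE x in \<mu>. (\<lambda>n. exp (- u n * x)) \<longlonglongrightarrow> 1"
    proof (rule AE_I2)
      fix x
      have "(\<lambda>n. exp (- u n * x)) \<longlonglongrightarrow> exp (- 0 * x)"
        by (intro tendsto_intros u(2))
      then show "(\<lambda>n. exp (- u n * x)) \<longlonglongrightarrow> 1" by simp
    qed
    show "AE x in \<mu>. norm (exp (- u n * x)) \<le> 1" for n
      using nonneg_law_AE[OF \<mu>] by eventually_elim (use u(1) in auto)
  qed auto
  then have "(\<lambda>n. exp (- laplace_exponent \<mu> (u n))) \<longlonglongrightarrow> 1"
    using laplace_transform_eq_exponent[OF \<mu> u(1)] prob_space by simp
  from tendsto_minus[OF tendsto_ln[OF this]] show ?thesis by simp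
qed

lemma c_factor_eqI:
  assumes "nonneg_law \<nu>"
    and "\<And>u. 0 \<le> u \<Longrightarrow> laplace_exponent \<nu> u =
        (if c < 1 then laplace_exponent \<mu> u - laplace_exponent \<mu> (c * u)
         else laplace_exponent \<mu> (c * u) - laplace_exponent \<mu> u)"
  shows "c_factor c \<mu> = \<nu>"
  unfolding c_factor_def
proof (rule the_equality)
  fix \<kappa>
  assume \<kappa>: "nonneg_law \<kappa> \<and> (\<forall>u\<ge>0. laplace_exponent \<kappa> u =
      (if c < 1 then laplace_exponent \<mu> u - laplace_exponent \<mu> (c * u)
       else laplace_exponent \<mu> (c * u) - laplace_exponent \<mu> u))"
  show "\<kappa> = \<nu>"
    by (rule nonneg_law_eqI) (use \<kappa> assms in simp_all)
qed (use assms in blast)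

text \<open>If \<open>X = c X' + Y\<close> and \<open>m\<close> is the essential infimum of \<open>X\<close>, then that of \<open>Y\<close> is at least
  \<open>(1 - c) m \<ge> 0\<close>.\<close>

lemma nonneg_law_selfdecomposable_factor:
  assumes \<mu>: "nonneg_law \<mu>" and c: "0 < c" "c < 1" and \<nu>: "real_distribution \<nu>"
    and eq: "\<mu> = (distr \<mu> borel (\<lambda>x. c * x) \<star> \<nu>)"
  shows "nonneg_law \<nu>"
proof -
  interpret M: real_distribution \<mu> by (rule nonneg_law_real_distribution[OF \<mu>])
  interpret N: real_distribution \<nu> by fact
  define \<kappa> where "\<kappa> = distr \<mu> borel (\<lambda>x. c * x)"
  interpret K: real_distribution \<kappa> unfolding \<kappa>_def by (rule M.real_distribution_distr) measurable
  interpret pair_prob_space \<kappa> \<nu> ..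
  define S where "S = {x. 0 < measure \<mu> {..x}}"
  have neg: "measure \<mu> {..x} = 0" if "x < 0" for x
  proof -
    have "AE y in \<mu>. y \<notin> {..x}"
      using nonneg_law_AE[OF \<mu>] by eventually_elim (use that in auto)
    then show ?thesis by (subst M.prob_eq_0) auto
  qed
  have S_lower: "0 \<le> x" if "x \<in> S" for x
    using that neg[of x] by (fastforce simp: S_def)
  then have bdd: "bdd_below S" by (meson bdd_belowI)
  have "\<forall>\<^sub>F x in at_top. 0 < cdf \<mu> x"
    using order_tendstoD(1)[OF M.cdf_lim_at_top_prob, of 0] by simp
  then obtain x0 where "0 < cdf \<mu> x0" unfolding eventually_at_top_linorder by blast
  then have ne: "S \<noteq> {}" by (auto simp: S_def cdf_def)
  have Inf_nn: "0 \<le> Inf S" using ne S_lower by (rule cInf_greatest)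
  have zero: "measure \<nu> {..z} = 0" if z: "z < 0" for z
  proof -
    \<comment> \<open>For z < 0 some x in S is so close to \<open>Inf S\<close> that c x + z falls
      below \<open>Inf S\<close>. Independence bounds the product of the masses of
      \<open>{..x}\<close> under \<open>\<mu>\<close> and \<open>{..z}\<close> under
      \<open>\<nu>\<close> by the mass of \<open>{..c * x + z}\<close> under \<open>\<mu>\<close>,
      which is 0; the first factor is positive.\<close>
    have "c * Inf S \<le> Inf S" using c Inf_nn by (simp add: mult_left_le_one_le)
    with z have "Inf S < (Inf S - z) / c" using c by (simp add: field_simps)
    then obtain x where x: "x \<in> S" "x < (Inf S - z) / c" using cInf_lessD[OF ne] by blast
    then have "c * x + z < Inf S" using c by (simp add: field_simps)
    then have "c * x + z \<notin> S" using cInf_lower[OF _ bdd] by (meson not_less)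
    then have "measure \<mu> {..c * x + z} = 0"
      by (simp add: S_def not_less measure_le_0_iff)
    moreover have "measure \<mu> {..x} * measure \<nu> {..z} \<le> measure \<mu> {..c * x + z}"
    proof -
      have "measure \<mu> {..x} = measure \<kappa> {..c * x}"
        unfolding \<kappa>_def using c by (subst measure_distr) (auto intro!: arg_cong[where f = "measure \<mu>"])
      then have "measure \<mu> {..x} * measure \<nu> {..z} = measure (\<kappa> \<Otimes>\<^sub>M \<nu>) ({..c * x} \<times> {..z})"
        by (simp add: measure_def N.emeasure_pair_measure_Times enn2real_mult)
      also have "\<dots> \<le> measure (\<kappa> \<Otimes>\<^sub>M \<nu>) ((\<lambda>(x, y). x + y) -` {..c * x + z} \<inter> space (\<kappa> \<Otimes>\<^sub>M \<nu>))"
        using measurable_sets[of "\<lambda>(x, y). x + y" "\<kappa> \<Otimes>\<^sub>M \<nu>" borel "{..c * x + z}"]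
        by (intro finite_measure_mono) (auto simp: space_pair_measure)
      also have "\<dots> = measure (\<kappa> \<star> \<nu>) {..c * x + z}"
        unfolding convolution_def by (subst measure_distr) auto
      finally show ?thesis using eq by (simp add: \<kappa>_def)
    qed
    ultimately have "measure \<mu> {..x} * measure \<nu> {..z} \<le> 0" by simp
    then show ?thesis using x(1) by (auto simp: S_def mult_le_0_iff measure_le_0_iff)
  qed
  have "AE y in \<nu>. y \<notin> {..- (1 / Suc n)}" for n :: nat
    using zero[of "- (1 / Suc n)"] N.prob_eq_0[of "{..- (1 / Suc n)}"] by simp
  then have "AE y in \<nu>. \<forall>n::nat. y \<notin> {..- (1 / Suc n)}"
    by (intro AE_all_countable[THEN iffD2] allI)
  then have "AE y in \<nu>. 0 \<le> y"
  proof eventually_elim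
    case (elim y)
    show ?case
    proof (rule ccontr)
      assume "\<not> 0 \<le> y"
      then obtain n :: nat where "1 / Suc n < - y"
        using reals_Archimedean[of "- y"] by (auto simp: inverse_eq_divide)
      with elim show False by (auto dest: spec[of _ n])
    qed
  qed
  with \<nu> show ?thesis by (simp add: nonneg_law_def)
qed

lemma selfdecomposable_factor:
  assumes \<mu>: "nonneg_law \<mu>" "selfdecomposable \<mu>" and c: "0 < c" "c < 1"
  shows "\<exists>\<nu>. nonneg_law \<nu> \<and>
    (\<forall>u\<ge>0. laplace_exponent \<nu> u = laplace_exponent \<mu> u - laplace_exponent \<mu> (c * u))"
proof -
  obtain \<nu> where \<nu>: "real_distribution \<nu>" "\<mu> = (distr \<mu> borel (\<lambda>x. c * x) \<star> \<nu>)"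
    using \<mu>(2)[unfolded selfdecomposable_def, rule_format, of c] c by force
  have nn: "nonneg_law \<nu>" by (rule nonneg_law_selfdecomposable_factor[OF \<mu>(1) c \<nu>])
  have "laplace_exponent \<mu> u = laplace_exponent \<mu> (c * u) + laplace_exponent \<nu> u" if u: "0 \<le> u" for u
  proof -
    have "laplace_exponent \<mu> u = laplace_exponent (distr \<mu> borel (\<lambda>x. c * x) \<star> \<nu>) u"
      using \<nu>(2) by simp
    also have "\<dots> = laplace_exponent \<mu> (c * u) + laplace_exponent \<nu> u"
      using nonneg_law_convolution(2)[OF nonneg_law_scale(1)[OF \<mu>(1)] nn u, of c]
        nonneg_law_scale(2)[OF \<mu>(1) _ u, of c] c by simp
    finally show ?thesis .
  qed
  with nn show ?thesis by (intro exI[of _ \<nu>]) auto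
qed

lemma BO_iff_levy:
  "\<mu> \<in> BO \<longleftrightarrow> nonneg_law \<mu> \<and> (\<exists>a l. 0 \<le> a \<and> levy_density l \<and> completely_monotone l \<and>
     (\<forall>u\<ge>0. laplace_exponent \<mu> u = a * u + levy_integral l u))" (is "_ \<longleftrightarrow> ?R")
proof
  assume "\<mu> \<in> BO"
  then show ?R unfolding BO_def exponent_form_iff_levy by auto
next
  assume ?R
  then obtain a l where l: "nonneg_law \<mu>" "0 \<le> a" "levy_density l" "completely_monotone l"
    "\<And>u. 0 \<le> u \<Longrightarrow> laplace_exponent \<mu> u = a * u + levy_integral l u" by auto
  have eq: "l t = t * l t / t" if "0 < t" for t using that by simp
  have "exponent_form (laplace_exponent \<mu>) a (\<lambda>t. t * l t)"
    unfolding exponent_form_iff_levy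
    using l levy_density_cong[OF eq] by auto
  moreover have "completely_monotone (\<lambda>t. t * l t / t)"
    by (rule completely_monotone_cong[OF l(4) eq])
  ultimately show "\<mu> \<in> BO" using l(1) unfolding BO_def by blast
qed

section \<open>From T to BO\<close>

lemma BO_factor_of_GGC_exponent:
  assumes ef: "exponent_form \<psi> a k" and k: "completely_monotone k" and c: "0 < c" "c < 1"
  shows "\<exists>\<nu>\<in>BO. \<forall>u\<ge>0. laplace_exponent \<nu> u = \<psi> u - \<psi> (c * u)"
proof -
  let ?m = "\<lambda>t. k t / t"
  let ?l = "\<lambda>t. ?m t - ?m (t / c) / c"
  have m: "0 \<le> a" "levy_density ?m" "\<And>u. 0 \<le> u \<Longrightarrow> \<psi> u = a * u + levy_integral ?m u"
    using ef unfolding exponent_form_iff_levy by auto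
  have l_eq: "?l t = (k t - k (1 / c * t)) / t" for t
    using c by (simp add: diff_divide_distrib)
  have cm: "completely_monotone ?l"
    unfolding l_eq using c by (intro completely_monotone_scale_quotient[OF k]) simp
  \<comment> \<open>Complete monotonicity includes nonnegativity, and this makes the difference of
    the two densities a Levy density.\<close>
  have le: "?m (t / c) / c \<le> ?m t" if "0 < t" for t
    using completely_monotone_nonneg[OF cm that] by simp
  note sc = levy_scale[OF m(2) c(1)]
  have l: "levy_density ?l" by (rule levy_diff(1)[OF m(2) sc(1) le])
  have li: "levy_integral ?l u = levy_integral ?m u - levy_integral ?m (c * u)" if "0 \<le> u" for u
    using levy_diff(2)[OF m(2) sc(1) le that] sc(2) by simp
  have ac: "0 \<le> a * (1 - c)" using m(1) c by simp
  obtain \<nu> where \<nu>: "nonneg_law \<nu>" "\<And>u. 0 \<le> u \<Longrightarrow> laplace_exponent \<nu> u = a * (1 - c) * u + levy_integral ?l u"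
    using nonneg_law_of_levy_density[OF l ac] by blast
  have "\<nu> \<in> BO" unfolding BO_iff_levy using \<nu> ac l cm by blast
  moreover have "laplace_exponent \<nu> u = \<psi> u - \<psi> (c * u)" if u: "0 \<le> u" for u
    using \<nu>(2)[OF u] li[OF u] m(3)[OF u] m(3)[of "c * u"] u c by (simp add: algebra_simps)
  ultimately show ?thesis by blast
qed

lemma c_factor_of_GGC_in_BO:
  assumes \<mu>: "\<mu> \<in> GGC" and c: "0 < c" "c \<noteq> 1"
  shows "c_factor c \<mu> \<in> BO"
proof -
  obtain a k where k: "exponent_form (laplace_exponent \<mu>) a k" "completely_monotone k"
    using \<mu> unfolding GGC_def by blast
  show ?thesis
  proof (cases "c < 1")
    case True
    from BO_factor_of_GGC_exponent[OF k c(1) this] obtain \<nu> where \<nu>: "\<nu> \<in> BO"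
      "\<And>u. 0 \<le> u \<Longrightarrow> laplace_exponent \<nu> u = laplace_exponent \<mu> u - laplace_exponent \<mu> (c * u)" by blast
    then have "c_factor c \<mu> = \<nu>" using True by (intro c_factor_eqI) (auto simp: BO_def)
    with \<nu>(1) show ?thesis by simp
  next
    case False
    let ?m = "\<lambda>t. k t / t"
    have m: "0 \<le> a" "levy_density ?m" "\<And>u. 0 \<le> u \<Longrightarrow> laplace_exponent \<mu> u = a * u + levy_integral ?m u"
      using k(1) unfolding exponent_form_iff_levy by auto
    have eq: "?m (t / c) / c = k (t / c) / t" for t using c by simp
    note sc = levy_scale[OF m(2) c(1), unfolded eq]
    \<comment> \<open>For c > 1 the roles are exchanged: the dilated exponent has the same form with
      \<open>k (t / c)\<close>, and its factor for 1/c is \<open>\<psi>(c u) - \<psi>(u)\<close>.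
      This is why the preceding lemma speaks of an arbitrary function \<open>\<psi>\<close>.\<close>
    have "exponent_form (\<lambda>u. laplace_exponent \<mu> (c * u)) (a * c) (\<lambda>t. k (t / c))"
      unfolding exponent_form_iff_levy using m(1,3) sc c by auto
    moreover have "completely_monotone (\<lambda>t. k (t / c))"
      using completely_monotone_scale[OF k(2), of "1 / c" 1] c by simp
    ultimately obtain \<nu> where \<nu>: "\<nu> \<in> BO" "\<And>u. 0 \<le> u \<Longrightarrow>
        laplace_exponent \<nu> u = laplace_exponent \<mu> (c * u) - laplace_exponent \<mu> (c * (1 / c * u))"
      using BO_factor_of_GGC_exponent[of _ _ _ "1 / c"] c False by force
    then have "c_factor c \<mu> = \<nu>" using False c by (intro c_factor_eqI) (auto simp: BO_def)
    with \<nu>(1) show ?thesis by simp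
  qed
qed

section \<open>From BO back to T\<close>

lemma AE_lborel_ex_interval:
  fixes a b :: real
  assumes "AE x in lborel. P x" "a < b"
  shows "\<exists>x. a < x \<and> x < b \<and> P x"
proof (rule ccontr)
  assume none: "\<not> ?thesis"
  have "AE x in lborel. x \<notin> {a<..<b}"
    using assms(1) by eventually_elim (use none in auto)
  then have "emeasure lborel {a<..<b} = 0"
    by (subst (asm) AE_iff_measurable[where N = "{a<..<b}"]) auto
  then show False using assms(2) by simp
qed

text \<open>Upgrades the almost everywhere uniqueness of Levy densities. The approximating points
  lie to the right of t, hence stay positive.\<close>

lemma AE_eq_imp_eq_isCont:
  fixes f g :: "real \<Rightarrow> real"
  assumes ae: "AE x in lborel. 0 < x \<longrightarrow> f x = g x" and "isCont f t" "isCont g t" "0 < t"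
  shows "f t = g t"
proof -
  have "\<exists>x. t < x \<and> x < t + 1 / Suc n \<and> (0 < x \<longrightarrow> f x = g x)" for n :: nat
    by (rule AE_lborel_ex_interval[OF ae]) simp
  then obtain x where x: "\<And>n. t < x n" "\<And>n. x n < t + 1 / Suc n"
    "\<And>n. 0 < x n \<Longrightarrow> f (x n) = g (x n)" by metis
  have "x \<longlonglongrightarrow> t"
  proof (rule tendsto_sandwich[where f = "\<lambda>_. t" and h = "\<lambda>n. t + 1 / Suc n"])
    show "(\<lambda>n. t + 1 / Suc n) \<longlonglongrightarrow> t"
      using tendsto_add[OF tendsto_const LIMSEQ_inverse_real_of_nat, of t] by (simp add: inverse_eq_divide)
  qed (use x in \<open>auto intro!: always_eventually less_imp_le\<close>)
  then have "(\<lambda>n. f (x n)) \<longlonglongrightarrow> f t" "(\<lambda>n. g (x n)) \<longlonglongrightarrow> g t"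
    using assms(2,3) by (auto intro: isCont_tendsto_compose)
  moreover have "f (x n) = g (x n)" for n
    using x(1)[of n] \<open>0 < t\<close> by (intro x(3)) simp
  ultimately show ?thesis using LIMSEQ_unique by simp
qed

text \<open>Iterating \<open>\<psi>(u) - \<psi>(u/2) = a u + \<integral>(1 - e\<^sup>-\<^sup>u\<^sup>t) l(t) dt\<close> gives the Levy density
  \<open>\<Sum>\<^sub>j 2\<^sup>j l(2\<^sup>j t)\<close> of \<open>\<psi>\<close>.\<close>

lemma levy_density_from_half_factor:
  assumes \<mu>: "nonneg_law \<mu>" and l: "levy_density l" and cm: "completely_monotone l"
    and eq: "\<And>u. 0 \<le> u \<Longrightarrow>
      laplace_exponent \<mu> u - laplace_exponent \<mu> (u / 2) = a * u + levy_integral l u"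
  shows "\<exists>m. completely_monotone m \<and> levy_density m \<and>
    (\<forall>u\<ge>0. laplace_exponent \<mu> u = 2 * a * u + levy_integral m u)"
proof -
  define h where "h j t = 2 ^ j * l (2 ^ j * t)" for j :: nat and t :: real
  have h_eq: "h j t = l (t / (1 / 2 ^ j)) / (1 / 2 ^ j)" for j t
    by (simp add: h_def mult.commute)
  have h: "levy_density (h j)" "levy_integral (h j) u = levy_integral l (1 / 2 ^ j * u)" for j u
    unfolding h_eq[abs_def] using levy_scale[OF l, of "1 / 2 ^ j"] by auto
  have h_cm: "completely_monotone (h j)" for j
    unfolding h_def using completely_monotone_scale[OF cm] by simp
  note h_nn = levy_density_nonneg[OF h(1)]
  \<comment> \<open>The differences along u/2^j telescope. Their drift parts a u/2^j form a
    geometric series with sum 2 a u, which explains the drift in the conclusion.\<close>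
  have sums: "(\<lambda>j. levy_integral (h j) u) sums (laplace_exponent \<mu> u - 2 * a * u)"
    if u: "0 \<le> u" for u
  proof -
    have "(\<lambda>j. u * (1 / 2) ^ j) \<longlonglongrightarrow> u * 0"
      by (intro tendsto_mult_left LIMSEQ_realpow_zero) auto
    then have "(\<lambda>j. laplace_exponent \<mu> (u * (1 / 2) ^ j)) \<longlonglongrightarrow> 0"
      using u by (intro laplace_exponent_tendsto_0[OF \<mu>]) auto
    from telescope_sums'[OF this]
    have "(\<lambda>j. laplace_exponent \<mu> (u * (1 / 2) ^ j) - laplace_exponent \<mu> (u * (1 / 2) ^ Suc j))
        sums laplace_exponent \<mu> u" by simp
    moreover have "laplace_exponent \<mu> (u * (1 / 2) ^ j) - laplace_exponent \<mu> (u * (1 / 2) ^ Suc j)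
        = a * u * (1 / 2) ^ j + levy_integral (h j) u" for j
      using eq[of "u * (1 / 2) ^ j"] u h(2)[of j u] by (simp add: power_one_over field_simps)
    ultimately have "(\<lambda>j. a * u * (1 / 2) ^ j + levy_integral (h j) u) sums laplace_exponent \<mu> u"
      by simp
    from sums_diff[OF this sums_mult[OF geometric_sums[of "1 / 2 :: real"], of "a * u"]]
    show ?thesis by (simp add: mult_ac)
  qed
  let ?f = "\<lambda>u j t. indicator {0<..} t *\<^sub>R ((1 - exp (- u * t)) * h j t)"
  have f_int: "integrable lborel (?f u j)" if "0 \<le> u" for u j
    using levy_integrable[OF h(1) that] by (simp add: set_integrable_def)
  have f_nn: "0 \<le> ?f u j t" if "0 \<le> u" for u j t
    using that h_nn by (auto split: split_indicator)
  have f_sums: "(\<lambda>j. \<integral>t. ?f u j t \<partial>lborel) sums (laplace_exponent \<mu> u - 2 * a * u)" if "0 \<le> u" for u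
    using sums[OF that] by (simp add: levy_integral_def set_lebesgue_integral_def)
  \<comment> \<open>All terms are nonnegative, so convergence of the integrals at u = 1 makes the
    series of densities finite almost everywhere.\<close>
  have "AE t in lborel. (\<Sum>j. ennreal (?f 1 j t)) \<noteq> \<infinity>"
  proof (rule nn_integral_noteq_infinite)
    have [measurable]: "?f 1 j \<in> borel_measurable borel" for j
      using borel_measurable_integrable[OF f_int[of 1 j]] by simp
    show "(\<lambda>t. \<Sum>j. ennreal (?f 1 j t)) \<in> borel_measurable lborel" by measurable
    have "(\<integral>\<^sup>+t. (\<Sum>j. ennreal (?f 1 j t)) \<partial>lborel) = (\<Sum>j. \<integral>\<^sup>+t. ennreal (?f 1 j t) \<partial>lborel)"
      by (rule nn_integral_suminf) measurable
    also have "\<dots> = (\<Sum>j. ennreal (\<integral>t. ?f 1 j t \<partial>lborel))"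
      using f_int[of 1] f_nn[of 1] by (intro suminf_cong nn_integral_eq_integral) auto
    also have "\<dots> \<noteq> \<infinity>"
      using f_sums[of 1] f_nn[of 1]
      by (subst suminf_ennreal2) (auto simp: sums_iff intro!: integral_nonneg_AE)
    finally show "(\<integral>\<^sup>+t. (\<Sum>j. ennreal (?f 1 j t)) \<partial>lborel) \<noteq> \<infinity>" .
  qed
  then have ae: "AE t in lborel. 0 < t \<longrightarrow> summable (\<lambda>j. h j t)"
  proof eventually_elim
    case (elim t)
    show ?case
    proof
      assume t: "0 < t"
      have "summable (\<lambda>j. ?f 1 j t)"
        using elim f_nn[of 1] by (intro summable_suminf_not_top) auto
      then have "summable (\<lambda>j. inverse (1 - exp (- t)) * ?f 1 j t)" by (rule summable_mult)
      then show "summable (\<lambda>j. h j t)" using t by simp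
    qed
  qed
  \<comment> \<open>Almost everywhere becomes everywhere: each \<open>h j\<close> is nonincreasing,
    so convergence at some s < t gives convergence at t, and the interval (0, t) contains such an
    s.\<close>
  have summ: "summable (\<lambda>j. h j t)" if t: "0 < t" for t
  proof -
    obtain s where s: "0 < s" "s < t" "summable (\<lambda>j. h j s)"
      using AE_lborel_ex_interval[OF ae t] by blast
    show ?thesis
    proof (rule summable_comparison_test'[OF s(3)])
      show "norm (h j t) \<le> h j s" if "0 \<le> j" for j
        using completely_monotone_antimono[OF h_cm s(1), of t j] s(2) h_nn[OF t, of j] by simp
    qed
  qed
  define m where "m t = (\<Sum>j. h j t)" for t
  have m_cm: "completely_monotone m"
    unfolding m_def by (rule completely_monotone_suminf[OF h_cm summ])
  have m_f: "indicator {0<..} t *\<^sub>R ((1 - exp (- u * t)) * m t) = (\<Sum>j. ?f u j t)" for u t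
  proof (cases "0 < t")
    case True
    then show ?thesis by (simp add: m_def suminf_mult[OF summ])
  qed simp
  have f_summ: "summable (\<lambda>j. norm (?f u j t))" if u: "0 \<le> u" for u t
    unfolding real_norm_def abs_of_nonneg[OF f_nn[OF u]]
  proof (cases "0 < t")
    case True
    show "summable (\<lambda>j. ?f u j t)" using True summable_mult[OF summ[OF True]] by simp
  qed simp
  have norm_f: "(\<integral>t. norm (?f u j t) \<partial>lborel) = (\<integral>t. ?f u j t \<partial>lborel)" if "0 \<le> u" for u j
    using f_nn[OF that] by (simp only: real_norm_def abs_of_nonneg)
  have int_summ: "summable (\<lambda>j. \<integral>t. norm (?f u j t) \<partial>lborel)" if "0 \<le> u" for u
    unfolding norm_f[OF that] using f_sums[OF that] by (rule sums_summable)
  have "integrable lborel (\<lambda>t. \<Sum>j. ?f 1 j t)"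
    by (intro integrable_suminf f_int int_summ AE_I2 f_summ) simp_all
  then have "set_integrable lborel {0<..} (\<lambda>t. (1 - exp (- 1 * t)) * m t)"
    unfolding set_integrable_def m_f .
  then have m: "levy_density m"
    using completely_monotone_nonneg[OF m_cm] by (intro levy_densityI) auto
  have "levy_integral m u = laplace_exponent \<mu> u - 2 * a * u" if u: "0 \<le> u" for u
  proof -
    have "(\<lambda>j. \<integral>t. ?f u j t \<partial>lborel) sums (\<integral>t. (\<Sum>j. ?f u j t) \<partial>lborel)"
      by (intro sums_integral f_int int_summ AE_I2 f_summ u)
    with f_sums[OF u] show ?thesis
      unfolding levy_integral_def set_lebesgue_integral_def m_f by (simp only: sums_unique2)
  qed
  with m m_cm show ?thesis by (intro exI[of _ m]) auto
qed

text \<open>The hypothesis concerns exponents only, so that factors with c < 1 and dilated factors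
  with c > 1 both provide it.\<close>

lemma GGC_from_BO_factors:
  assumes \<mu>: "nonneg_law \<mu>"
    and factor: "\<And>c. 0 < c \<Longrightarrow> c < 1 \<Longrightarrow> \<exists>a l. 0 \<le> a \<and> levy_density l \<and> completely_monotone l \<and>
      (\<forall>u\<ge>0. laplace_exponent \<mu> u - laplace_exponent \<mu> (c * u) = a * u + levy_integral l u)"
  shows "\<mu> \<in> GGC"
proof -
  obtain a m where a: "0 \<le> a" and m: "completely_monotone m" "levy_density m"
    "\<And>u. 0 \<le> u \<Longrightarrow> laplace_exponent \<mu> u = 2 * a * u + levy_integral m u"
    using factor[of "1 / 2"] levy_density_from_half_factor[OF \<mu>] by fastforce
  have quotient: "completely_monotone (\<lambda>t. (t * m t - b * t * m (b * t)) / t)" if b: "1 < b" for b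
  proof -
    define c where "c = 1 / b"
    have c: "0 < c" "c < 1" "b = 1 / c" using b by (auto simp: c_def)
    obtain a' l where l: "levy_density l" "completely_monotone l"
      "\<And>u. 0 \<le> u \<Longrightarrow> laplace_exponent \<mu> u - laplace_exponent \<mu> (c * u) = a' * u + levy_integral l u"
      using factor[OF c(1,2)] by blast
    note sc = levy_scale[OF m(2) c(1)]
    \<comment> \<open>Writing \<open>\<psi>(u)\<close> as the sum of
      \<open>\<psi>(u) - \<psi>(c u)\<close> and \<open>\<psi>(c u)\<close> gives a second
      representation of the same exponent. Its drift looks different, but uniqueness of the density
      does not depend on that.\<close>
    have ae: "AE t in lborel. 0 < t \<longrightarrow> m t = l t + m (t / c) / c"
    proof (rule levy_density_unique[OF m(2) levy_add(1)[OF l(1) sc(1)]])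
      fix u :: real assume u: "0 \<le> u"
      then show "2 * a * u + levy_integral m u
          = (a' + 2 * a * c) * u + levy_integral (\<lambda>t. l t + m (t / c) / c) u"
        using l(3)[OF u] m(3)[OF u] m(3)[of "c * u"] c levy_add(2)[OF l(1) sc(1) u] sc(2)[of u]
        by (simp add: algebra_simps)
    qed
    have m_eq: "m t = l t + b * m (b * t)" if t: "0 < t" for t
    proof -
      have "isCont m (t / c)" using t c by (intro completely_monotone_isCont[OF m(1)]) simp
      then have "isCont (\<lambda>t. m (t / c)) t"
        using c(1) by (intro isCont_o2[where f = "\<lambda>t. t / c" and g = m]) (auto intro: isCont_divide)
      then have "isCont (\<lambda>t. l t + m (t / c) / c) t"
        using c(1) completely_monotone_isCont[OF l(2) t] by (auto intro: isCont_add isCont_divide)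
      from AE_eq_imp_eq_isCont[OF ae completely_monotone_isCont[OF m(1) t] this t]
      show ?thesis using c(3) by simp
    qed
    show ?thesis
    proof (rule completely_monotone_cong[OF l(2)])
      fix t :: real assume t: "0 < t"
      show "l t = (t * m t - b * t * m (b * t)) / t"
        using m_eq[OF t] t by (simp add: field_simps)
    qed
  qed
  \<comment> \<open>Smoothness of m now gives k(t) = t m(t) a derivative family by Leibniz's rule.
    Its signs are unknown until the criterion through dilates is applied.\<close>
  obtain M where M: "alternating_derivs M" "\<And>t. 0 < t \<Longrightarrow> M 0 t = m t"
    using completely_monotoneE[OF m(1)] by metis
  \<comment> \<open>The left side is the member n = 0 of the Leibniz family, left unsimplified to
    match \<open>alternating_derivs_times_id\<close>.\<close>
  have k_eq: "t * M 0 t - real 0 * M (0 - 1) t = t * m t" if "0 < t" for t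
    using M(2)[OF that] by simp
  have "completely_monotone (\<lambda>t. t * M 0 t - real 0 * M (0 - 1) t)"
  proof (rule completely_monotone_from_scale_quotients[OF alternating_derivs_times_id[OF M(1)]])
    show "0 \<le> t * M 0 t - real 0 * M (0 - 1) t" if "0 < t" for t
      unfolding k_eq[OF that] using levy_density_nonneg[OF m(2) that] that by simp
    show "completely_monotone (\<lambda>t. (t * M 0 t - real 0 * M (0 - 1) t
        - (b * t * M 0 (b * t) - real 0 * M (0 - 1) (b * t))) / t)" if b: "1 < b" for b
    proof (rule completely_monotone_cong[OF quotient[OF b]])
      fix t :: real assume t: "0 < t"
      have bt: "0 < b * t" using b t by simp
      show "(t * m t - b * t * m (b * t)) / t = (t * M 0 t - real 0 * M (0 - 1) t
          - (b * t * M 0 (b * t) - real 0 * M (0 - 1) (b * t))) / t"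
        unfolding k_eq[OF t] k_eq[OF bt] by (rule refl)
    qed
  qed
  then have k: "completely_monotone (\<lambda>t. t * m t)"
    using k_eq by (rule completely_monotone_cong)
  have eq: "m t = t * m t / t" if "0 < t" for t using that by simp
  have "exponent_form (laplace_exponent \<mu>) (2 * a) (\<lambda>t. t * m t)"
    unfolding exponent_form_iff_levy using a m(2,3) levy_density_cong[OF eq] by auto
  with k \<mu> show ?thesis unfolding GGC_def by blast
qed

text \<open>Selfdecomposability provides an actual factor law, by which the description in
  \<open>c_factor\<close> can be evaluated before membership in \<open>BO\<close> is
  exploited.\<close>

lemma GGC_if_c_factors_in_BO:
  assumes \<mu>: "nonneg_law \<mu>" "selfdecomposable \<mu>"
    and BO: "(\<forall>c\<in>{0<..<1}. c_factor c \<mu> \<in> BO) \<or> (\<forall>c>1. c_factor c \<mu> \<in> BO)"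
  shows "\<mu> \<in> GGC"
proof (rule GGC_from_BO_factors[OF \<mu>(1)])
  fix c :: real assume c: "0 < c" "c < 1"
  obtain \<nu> where \<nu>: "nonneg_law \<nu>"
    "\<And>u. 0 \<le> u \<Longrightarrow> laplace_exponent \<nu> u = laplace_exponent \<mu> u - laplace_exponent \<mu> (c * u)"
    using selfdecomposable_factor[OF \<mu> c] by blast
  from BO show "\<exists>a l. 0 \<le> a \<and> levy_density l \<and> completely_monotone l \<and>
      (\<forall>u\<ge>0. laplace_exponent \<mu> u - laplace_exponent \<mu> (c * u) = a * u + levy_integral l u)"
  proof
    assume "\<forall>c\<in>{0<..<1}. c_factor c \<mu> \<in> BO"
    moreover have "c_factor c \<mu> = \<nu>" using \<nu> c by (intro c_factor_eqI) auto
    ultimately have "\<nu> \<in> BO" using c by force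
    then show ?thesis using \<nu>(2) unfolding BO_iff_levy by auto
  next
    assume "\<forall>c>1. c_factor c \<mu> \<in> BO"
    \<comment> \<open>Dilating the c-factor by 1/c gives the exponent
      \<open>\<psi>(u/c) - \<psi>(u)\<close>, that of the factor for 1/c > 1. Dilating by c
      afterwards carries its Levy density back.\<close>
    moreover define \<nu>' where "\<nu>' = distr \<nu> borel (\<lambda>x. 1 / c * x)"
    have \<nu>': "nonneg_law \<nu>'" "\<And>u. 0 \<le> u \<Longrightarrow>
        laplace_exponent \<nu>' u = laplace_exponent \<mu> (1 / c * u) - laplace_exponent \<mu> u"
    proof -
      show "nonneg_law \<nu>'" unfolding \<nu>'_def using c by (intro nonneg_law_scale(1)[OF \<nu>(1)]) simp
      fix u :: real assume u: "0 \<le> u"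
      have "laplace_exponent \<nu>' u = laplace_exponent \<nu> (1 / c * u)"
        unfolding \<nu>'_def using c u by (intro nonneg_law_scale(2)[OF \<nu>(1)]) auto
      then show "laplace_exponent \<nu>' u = laplace_exponent \<mu> (1 / c * u) - laplace_exponent \<mu> u"
        using \<nu>(2)[of "1 / c * u"] c u by simp
    qed
    moreover have "c_factor (1 / c) \<mu> = \<nu>'" using \<nu>' c by (intro c_factor_eqI) auto
    ultimately have "\<nu>' \<in> BO" using c by force
    then obtain a l where l: "0 \<le> a" "levy_density l" "completely_monotone l"
      "\<And>u. 0 \<le> u \<Longrightarrow> laplace_exponent \<nu>' u = a * u + levy_integral l u"
      unfolding BO_iff_levy by blast
    note sc = levy_scale[OF l(2) c(1)]
    have "completely_monotone (\<lambda>t. l (t / c) / c)"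
      using completely_monotone_scale[OF l(3), of "1 / c" "1 / c"] c by simp
    moreover have "laplace_exponent \<mu> u - laplace_exponent \<mu> (c * u)
        = a * c * u + levy_integral (\<lambda>t. l (t / c) / c) u" if u: "0 \<le> u" for u
      using l(4)[of "c * u"] \<nu>'(2)[of "c * u"] sc(2)[of u] c u by simp
    moreover have "0 \<le> a * c" using l(1) c by simp
    ultimately show ?thesis using sc(1) by blast
  qed
qed

theorem proposition3p7:
  fixes \<mu> :: "real measure"
  shows "(\<mu> \<in> GGC \<longrightarrow> (\<forall>c>0. c \<noteq> 1 \<longrightarrow> c_factor c \<mu> \<in> BO)) \<and>
         (nonneg_law \<mu> \<and> selfdecomposable \<mu> \<and>
            ((\<forall>c\<in>{0<..<1}. c_factor c \<mu> \<in> BO) \<or> (\<forall>c>1. c_factor c \<mu> \<in> BO))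
          \<longrightarrow> \<mu> \<in> GGC)"
  using c_factor_of_GGC_in_BO GGC_if_c_factors_in_BO by blast

end
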